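(* Let $A\in\mathbb{C}^{n\times N}$, let $S\subset\{1,\dots,N\}$ with $|S|=k$ such that $A_S$ has full column rank, and suppose that for some $\alpha<1$ $$\|A_S^\dagger a_\ell\|_2\le\alpha\quad\text{for all }\ell\notin S.$$ Let $X\in\mathbb{C}^{N\times L}$ have all rows outside $S$ equal to zero and $X^S=\Sigma\Phi$, where $\Sigma\in\mathbb{R}^{k\times k}$ is a (deterministic) diagonal matrix with positive diagonal entries and $\Phi\in\mathbb{R}^{k\times L}$ is drawn from the real Gaussian model or the real spherical model. Then with probability at least $$1-N\exp\Big(-\frac{L}{2}\big(\alpha^{-2}-\log(\alpha^{-2})-1\big)\Big)$$ $X$ is the unique solution of $\min_Z\|Z\|_{2,1}$ subject to $AZ=AX$. If instead $\Phi\in\mathbb{C}^{k\times L}$ is drawn from the complex Gaussian or complex spherical model, the same holds with $L/2$ replaced by $L$ in the probability bound.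
   Context: $a_\ell$ is the $\ell$-th column of $A$, $A_S$ the submatrix of columns indexed by $S$, $A_S^\dagger=(A_S^*A_S)^{-1}A_S^*$. For $X\in\mathbb{C}^{N\times L}$, $X^j$ is its $j$-th row, $X^S$ the rows indexed by $S$, and $\|X\|_{2,1}=\sum_j\|X^j\|_2$. Probability models for $\Phi$: real Gaussian — all entries independent standard normal; real spherical — rows independent, each uniform on the unit sphere of $\mathbb{R}^L$; complex Gaussian — real and imaginary parts of all entries independent standard normal; complex spherical — rows independent, each uniform on the unit sphere of $\mathbb{C}^L$. *)

theory Defs
  imports "HOL-Probability.Probability"
begin

text \<open>Matrices/vectors of varying size are represented as functions on nat with
explicit bounds. Indices are 0-based: columns of A are indexed by 0..N-1.\<close>

definition full_col_rank :: "nat \<Rightarrow> (nat \<Rightarrow> nat \<Rightarrow> complex) \<Rightarrow> nat set \<Rightarrow> bool" where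
  "full_col_rank n A S \<longleftrightarrow>
     (\<forall>c::nat \<Rightarrow> complex. (\<forall>i<n. (\<Sum>l\<in>S. A i l * c l) = 0) \<longrightarrow> (\<forall>l\<in>S. c l = 0))"

text \<open>The pseudo-inverse applied to a vector: A_S^dagger a = (A_S^* A_S)^{-1} A_S^* a,
i.e. the unique vector c indexed by S with (A_S^* A_S) c = A_S^* a
(unique since A_S^* A_S is invertible when A_S has full column rank).\<close>
definition pinv_apply :: "nat \<Rightarrow> (nat \<Rightarrow> nat \<Rightarrow> complex) \<Rightarrow> nat set \<Rightarrow> (nat \<Rightarrow> complex) \<Rightarrow> (nat \<Rightarrow> complex)" where
  "pinv_apply n A S a = (THE c. (\<forall>j. j \<notin> S \<longrightarrow> c j = 0) \<and>
      (\<forall>j\<in>S. (\<Sum>i<n. cnj (A i j) * (\<Sum>m\<in>S. A i m * c m)) = (\<Sum>i<n. cnj (A i j) * a i)))"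

definition vnorm2 :: "nat set \<Rightarrow> (nat \<Rightarrow> 'a::real_normed_vector) \<Rightarrow> real" where
  "vnorm2 I c = sqrt (\<Sum>j\<in>I. (norm (c j))\<^sup>2)"

definition norm21 :: "nat \<Rightarrow> nat \<Rightarrow> (nat \<Rightarrow> nat \<Rightarrow> complex) \<Rightarrow> real" where
  "norm21 N L Z = (\<Sum>j<N. vnorm2 {..<L} (Z j))"

definition cmats :: "nat \<Rightarrow> nat \<Rightarrow> (nat \<Rightarrow> nat \<Rightarrow> complex) set" where
  "cmats N L = {Z. \<forall>j t. (N \<le> j \<or> L \<le> t) \<longrightarrow> Z j t = 0}"

definition matmul :: "nat \<Rightarrow> (nat \<Rightarrow> nat \<Rightarrow> complex) \<Rightarrow> (nat \<Rightarrow> nat \<Rightarrow> complex) \<Rightarrow> nat \<Rightarrow> nat \<Rightarrow> complex" where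
  "matmul N A Z i t = (\<Sum>j<N. A i j * Z j t)"

definition unique_l21_solution ::
  "nat \<Rightarrow> nat \<Rightarrow> nat \<Rightarrow> (nat \<Rightarrow> nat \<Rightarrow> complex) \<Rightarrow> (nat \<Rightarrow> nat \<Rightarrow> complex) \<Rightarrow> bool" where
  "unique_l21_solution n N L A X \<longleftrightarrow> X \<in> cmats N L \<and>
     (\<forall>Z\<in>cmats N L. (\<forall>i<n. \<forall>t<L. matmul N A Z i t = matmul N A X i t) \<and> Z \<noteq> X
        \<longrightarrow> norm21 N L X < norm21 N L Z)"

definition signal_mat ::
  "nat set \<Rightarrow> nat \<Rightarrow> (nat \<Rightarrow> real) \<Rightarrow> ('a \<Rightarrow> complex) \<Rightarrow> (nat \<Rightarrow> nat \<Rightarrow> 'a) \<Rightarrow> nat \<Rightarrow> nat \<Rightarrow> complex" where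
  "signal_mat S L \<sigma> emb \<Phi> j t = (if j \<in> S \<and> t < L then complex_of_real (\<sigma> j) * emb (\<Phi> j t) else 0)"

abbreviation lebesgue_vec :: "nat \<Rightarrow> (nat \<Rightarrow> 'a::euclidean_space) measure" where
  "lebesgue_vec L \<equiv> PiM {..<L} (\<lambda>_. lborel)"

text \<open>Uniform (normalized surface) measure on the unit sphere of K^L, defined as the
cone measure: sigma(B) = lambda({x in closed unit ball. x/|x| in B}) / lambda(unit ball).\<close>
definition sphere_row :: "nat \<Rightarrow> (nat \<Rightarrow> 'a::euclidean_space) measure" where
  "sphere_row L = distr (uniform_measure (lebesgue_vec L) {x \<in> space (lebesgue_vec L). vnorm2 {..<L} x \<le> 1})
      (PiM {..<L} (\<lambda>_. borel)) (\<lambda>x. restrict (\<lambda>t. (1 / vnorm2 {..<L} x) *\<^sub>R x t) {..<L})"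

definition complex_std_normal :: "complex measure" where
  "complex_std_normal = distr (std_normal_distribution \<Otimes>\<^sub>M std_normal_distribution) borel
      (\<lambda>(a, b). Complex a b)"

definition real_gauss_row :: "nat \<Rightarrow> (nat \<Rightarrow> real) measure" where
  "real_gauss_row L = PiM {..<L} (\<lambda>_. std_normal_distribution)"

definition complex_gauss_row :: "nat \<Rightarrow> (nat \<Rightarrow> complex) measure" where
  "complex_gauss_row L = PiM {..<L} (\<lambda>_. complex_std_normal)"

definition rows_model :: "nat set \<Rightarrow> (nat \<Rightarrow> 'a) measure \<Rightarrow> (nat \<Rightarrow> nat \<Rightarrow> 'a) measure" where
  "rows_model S R = PiM S (\<lambda>_. R)"

definition recovery_prob ::
  "nat \<Rightarrow> nat \<Rightarrow> nat \<Rightarrow> (nat \<Rightarrow> nat \<Rightarrow> complex) \<Rightarrow> nat set \<Rightarrow> (nat \<Rightarrow> real) \<Rightarrow>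
   ('a \<Rightarrow> complex) \<Rightarrow> (nat \<Rightarrow> 'a) measure \<Rightarrow> real" where
  "recovery_prob n N L A S \<sigma> emb R =
     measure (rows_model S R)
       {\<Phi> \<in> space (rows_model S R). unique_l21_solution n N L A (signal_mat S L \<sigma> emb \<Phi>)}"

end

theory Submission
  imports Defs
begin

text \<open>Convex duality reduces recovery to \<open>|\<Sum>\<^sub>j cnj (c\<^sub>j) s\<^sub>j| < 1\<close> for every column
  \<open>c = A\<^sub>S\<^sup>\<dagger> a\<^sub>l\<close>, where the \<open>s\<^sub>j\<close> are the normalised rows of \<open>\<Phi>\<close>. In all four models they are
  independent directions of standard Gaussian vectors in real dimension \<open>D\<close>. A coordinate of such a
  direction is sub-Gaussian with variance proxy \<open>1/D\<close>, because \<open>u \<mapsto> cosh (q \<surd>u)\<close> is convex and the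
  radius has mean square \<open>D\<close>. Linearising \<open>exp (\<theta> |y|\<^sup>2)\<close> by an auxiliary Gaussian vector therefore
  gives \<open>E exp (\<theta> |\<Sum>\<^sub>j cnj (c\<^sub>j) s\<^sub>j|\<^sup>2) \<le> \<alpha>\<^sup>-\<^sup>D\<close> for \<open>\<theta> = D (\<alpha>\<^sup>-\<^sup>2 - 1) / 2\<close>, and Markov's inequality with
  a union bound over the columns finishes the proof. Since the probability of a non-measurable set
  is \<open>0\<close> by convention, measurability of the recovery event has to be shown as well; it follows from
  compactness of the shells of the kernel of \<open>A\<close>.\<close>

section \<open>Dual certificates\<close>

text \<open>The rate comes from comparison with a Gaussian vector in real dimension D whose
  coordinates have variance \<alpha>^2/D. Its squared length Y satisfies E exp(\<theta> Y) = (1 - 2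
  \<theta> \<alpha>^2/D)^(-D/2), and minimising exp(-\<theta>) times this leads to the stated
  \<theta>, where the bracket equals \<alpha>^2. D is L for real rows and 2L for complex rows, which
  accounts for L/2 against L in the exponent. The obstacle is that directions are not Gaussian and
  that their coordinates are dependent. Independence of radius and direction would be the usual
  remedy; here its role is taken by the scaling behaviour of Lebesgue measure on functions that are
  constant on rays. All expectations are nonnegative integrals against the unnormalised weight
  exp(-|x|^2/2), so integrability is no issue and finiteness matters only where a term is cancelled.
  The diagonal matrix drops out because normalisation removes positive factors of the rows.\<close>

definition cdot :: "nat \<Rightarrow> (nat \<Rightarrow> complex) \<Rightarrow> (nat \<Rightarrow> complex) \<Rightarrow> complex" where
  "cdot n u v = (\<Sum>i<n. cnj (u i) * v i)"

section \<open>Normal equations and the pseudo-inverse\<close>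

lemma cdot_diff: "cdot n u (\<lambda>i. v i - w i) = cdot n u v - cdot n u w"
  and cdot_scale: "cdot n u (\<lambda>i. a * v i) = a * cdot n u v"
  and cdot_sum: "cdot n u (\<lambda>i. \<Sum>m\<in>S. f m i) = (\<Sum>m\<in>S. cdot n u (f m))"
  and cdot_diff_left: "cdot n (\<lambda>i. v i - w i) u = cdot n v u - cdot n w u"
  and cdot_sum_left: "cdot n (\<lambda>i. \<Sum>m\<in>S. f m i) u = (\<Sum>m\<in>S. cdot n (f m) u)"
  and cdot_scale_left: "cdot n (\<lambda>i. a * v i) u = cnj a * cdot n v u"
  and cnj_cdot: "cnj (cdot n u v) = cdot n v u"
proof -
  show "cdot n u (\<lambda>i. \<Sum>m\<in>S. f m i) = (\<Sum>m\<in>S. cdot n u (f m))"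
    unfolding cdot_def sum_distrib_left by (rule sum.swap)
  show "cdot n (\<lambda>i. \<Sum>m\<in>S. f m i) u = (\<Sum>m\<in>S. cdot n (f m) u)"
    unfolding cdot_def cnj_sum sum_distrib_right by (rule sum.swap)
qed (simp_all add: cdot_def algebra_simps sum.distrib sum_subtractf sum_distrib_left)

lemma cdot_self: "cdot n u u = complex_of_real (\<Sum>i<n. (norm (u i))\<^sup>2)"
  unfolding cdot_def of_real_sum complex_norm_square by (simp add: mult.commute)

lemma cdot_self_eq_0: "cdot n u u = 0 \<longleftrightarrow> (\<forall>i<n. u i = 0)"
  unfolding cdot_self of_real_eq_0_iff by (subst sum_nonneg_eq_0_iff) auto

lemma cdot_zero_right: "(\<forall>i<n. v i = 0) \<Longrightarrow> cdot n u v = 0"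
  by (simp add: cdot_def)

text \<open>A Gram-Schmidt step replaces matrix inversion: the problem on \<open>T\<close> is solved
  both for the new column \<open>s\<close> and for the target \<open>a\<close>, and one residual is
  then projected on the other. Dependent columns are allowed.\<close>

lemma normal_equations_solvable:
  assumes "finite S"
  shows "\<exists>c. (\<forall>j. j \<notin> S \<longrightarrow> c j = 0) \<and>
    (\<forall>j\<in>S. cdot n (\<lambda>i. A i j) (\<lambda>i. a i - (\<Sum>m\<in>S. A i m * c m)) = 0)"
  using assms
proof (induction S arbitrary: a rule: finite_induct)
  case empty
  show ?case by auto
next
  case (insert s T)
  obtain d where d: "\<And>j. j \<notin> T \<Longrightarrow> d j = 0"
    "\<And>j. j \<in> T \<Longrightarrow> cdot n (\<lambda>i. A i j) (\<lambda>i. A i s - (\<Sum>m\<in>T. A i m * d m)) = 0"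
    using insert.IH[of "\<lambda>i. A i s"] by blast
  obtain c where c: "\<And>j. j \<notin> T \<Longrightarrow> c j = 0"
    "\<And>j. j \<in> T \<Longrightarrow> cdot n (\<lambda>i. A i j) (\<lambda>i. a i - (\<Sum>m\<in>T. A i m * c m)) = 0"
    using insert.IH[of a] by blast
  define r where "r = (\<lambda>i. A i s - (\<Sum>m\<in>T. A i m * d m))"
  define q where "q = (\<lambda>i. a i - (\<Sum>m\<in>T. A i m * c m))"
  \<comment> \<open>Coefficient of the projection of \<open>q\<close> on \<open>r\<close>. If
    \<open>r\<close> vanishes, column \<open>s\<close> depends on \<open>T\<close> and the value 0
    serves.\<close>
  define g where "g = (if cdot n r r = 0 then 0 else cdot n r q / cdot n r r)"
  \<comment> \<open>\<open>r\<close> is column \<open>s\<close> minus its fit \<open>d\<close>, so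
    adding \<open>g\<close> times \<open>r\<close> to the fit shifts the coefficients on
    \<open>T\<close> by \<open>- g * d j\<close>.\<close>
  define c' where "c' = (\<lambda>j. if j = s then g else c j - g * d j)"
  have rT: "cdot n (\<lambda>i. A i j) r = 0" and qT: "cdot n (\<lambda>i. A i j) q = 0" if "j \<in> T" for j
    using d(2) c(2) that unfolding r_def q_def by auto
  \<comment> \<open>Column \<open>s\<close> and \<open>r\<close> differ by a combination of columns
    in \<open>T\<close>, hence pair alike with anything orthogonal to those columns.\<close>
  have As: "cdot n (\<lambda>i. A i s) v = cdot n r v" if "\<And>j. j \<in> T \<Longrightarrow> cdot n (\<lambda>i. A i j) v = 0" for v
  proof -
    have "cdot n r v = cdot n (\<lambda>i. A i s) v - (\<Sum>m\<in>T. cdot n (\<lambda>i. d m * A i m) v)"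
      unfolding r_def cdot_diff_left cdot_sum_left by (simp add: mult.commute)
    also have "(\<Sum>m\<in>T. cdot n (\<lambda>i. d m * A i m) v) = 0"
      using that by (intro sum.neutral) (simp add: cdot_scale_left)
    finally show ?thesis by simp
  qed
  have res: "(\<lambda>i. a i - (\<Sum>m\<in>insert s T. A i m * c' m)) = (\<lambda>i. q i - g * r i)"
  proof
    fix i
    have "(\<Sum>m\<in>insert s T. A i m * c' m) = A i s * g + (\<Sum>m\<in>T. A i m * c' m)"
      using insert.hyps by (simp add: c'_def)
    also have "(\<Sum>m\<in>T. A i m * c' m) = (\<Sum>m\<in>T. A i m * c m - g * (A i m * d m))"
      using insert.hyps by (intro sum.cong) (auto simp: c'_def algebra_simps)
    finally show "a i - (\<Sum>m\<in>insert s T. A i m * c' m) = q i - g * r i"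
      by (simp add: q_def r_def sum_subtractf sum_distrib_left algebra_simps)
  qed
  have T: "cdot n (\<lambda>i. A i j) (\<lambda>i. q i - g * r i) = 0" if "j \<in> T" for j
    using rT[OF that] qT[OF that] by (simp add: cdot_diff cdot_scale)
  have "cdot n r (\<lambda>i. q i - g * r i) = 0"
  proof (cases "cdot n r r = 0")
    case True
    have "cdot n q r = 0" using True cdot_self_eq_0 cdot_zero_right by blast
    then have "cdot n r q = 0" using cnj_cdot[of n q r] by simp
    then show ?thesis using True by (simp add: cdot_diff cdot_scale)
  next
    case False
    then have "g * cdot n r r = cdot n r q" by (simp add: g_def)
    then show ?thesis by (simp add: cdot_diff cdot_scale)
  qed
  then have s: "cdot n (\<lambda>i. A i s) (\<lambda>i. q i - g * r i) = 0"
    using As[OF T] by simp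
  show ?case
  proof (intro exI[of _ c'] conjI)
    show "\<forall>j. j \<notin> insert s T \<longrightarrow> c' j = 0" using c(1) d(1) by (simp add: c'_def)
    show "\<forall>j\<in>insert s T. cdot n (\<lambda>i. A i j) (\<lambda>i. a i - (\<Sum>m\<in>insert s T. A i m * c' m)) = 0"
      unfolding res using T s by blast
  qed
qed

lemma normal_equations_iff:
  "(\<Sum>i<n. cnj (A i j) * (\<Sum>m\<in>S. A i m * c m)) = (\<Sum>i<n. cnj (A i j) * a i)
    \<longleftrightarrow> cdot n (\<lambda>i. A i j) (\<lambda>i. a i - (\<Sum>m\<in>S. A i m * c m)) = 0"
  unfolding cdot_diff by (auto simp: cdot_def)

text \<open>Summing the relations with weights \<open>cnj (c m)\<close> gives squared length 0 for
  the combination of columns, so it vanishes and the rank condition applies.\<close>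

lemma gram_kernel_trivial:
  assumes rank: "full_col_rank n A S"
    and orth: "\<And>j. j \<in> S \<Longrightarrow> cdot n (\<lambda>i. A i j) (\<lambda>i. \<Sum>m\<in>S. A i m * c m) = 0"
    and "l \<in> S"
  shows "c l = 0"
proof -
  let ?v = "\<lambda>i. \<Sum>m\<in>S. A i m * c m"
  have "cdot n ?v ?v = (\<Sum>m\<in>S. cdot n (\<lambda>i. c m * A i m) ?v)"
    by (subst cdot_sum_left) (simp add: mult.commute)
  also have "\<dots> = 0" using orth by (intro sum.neutral) (simp add: cdot_scale_left)
  finally have "\<forall>i<n. ?v i = 0" by (simp add: cdot_self_eq_0)
  then show ?thesis using rank \<open>l \<in> S\<close> unfolding full_col_rank_def by blast
qed

text \<open>The definite description is usable only once existence and uniqueness are known.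
  Uniqueness among functions on all of \<open>nat\<close> relies on the prescribed value 0 outside
  \<open>S\<close>.\<close>

lemma pinv_apply_orthogonal:
  assumes fin: "finite S" and rank: "full_col_rank n A S" and "j \<in> S"
  shows "cdot n (\<lambda>i. A i j) (\<lambda>i. a i - (\<Sum>m\<in>S. A i m * pinv_apply n A S a m)) = 0"
proof -
  let ?P = "\<lambda>c. (\<forall>j. j \<notin> S \<longrightarrow> c j = 0) \<and>
    (\<forall>j\<in>S. cdot n (\<lambda>i. A i j) (\<lambda>i. a i - (\<Sum>m\<in>S. A i m * c m)) = 0)"
  have ex: "\<exists>c. ?P c" by (rule normal_equations_solvable[OF fin])
  have uniq: "c = c'" if "?P c" "?P c'" for c c'
  proof
    fix l
    have eq: "(\<lambda>i. \<Sum>m\<in>S. A i m * (c m - c' m)) =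
      (\<lambda>i. (a i - (\<Sum>m\<in>S. A i m * c' m)) - (a i - (\<Sum>m\<in>S. A i m * c m)))"
      by (auto simp: algebra_simps sum_subtractf)
    have "c l - c' l = 0" if "l \<in> S"
      by (rule gram_kernel_trivial[OF rank _ that]) (use \<open>?P c\<close> \<open>?P c'\<close> in \<open>simp add: eq cdot_diff\<close>)
    then show "c l = c' l" using that by (cases "l \<in> S") auto
  qed
  have "?P (THE c. ?P c)" by (rule theI'[OF ex_ex1I[OF ex uniq]])
  then have "?P (pinv_apply n A S a)" unfolding pinv_apply_def normal_equations_iff .
  then show ?thesis using \<open>j \<in> S\<close> by simp
qed

text \<open>A column outside \<open>S\<close> need not lie in the span of the columns in
  \<open>S\<close>, but its residual after the fit is orthogonal to them. Inserting the fits into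
  the kernel equation leaves a combination of columns in \<open>S\<close> that is orthogonal to all
  of them, so its coefficients \<open>?d\<close> vanish.\<close>

lemma kernel_rows_on_support:
  assumes S: "S \<subseteq> {..<N}" and rank: "full_col_rank n A S"
    and ker: "\<forall>i<n. (\<Sum>j<N. A i j * v j) = 0" and "j \<in> S"
  shows "v j = - (\<Sum>l\<in>{..<N} - S. pinv_apply n A S (\<lambda>i. A i l) j * v l)"
proof -
  let ?c = "\<lambda>l. pinv_apply n A S (\<lambda>i. A i l)"
  have fin: "finite S" using S finite_subset by blast
  let ?d = "\<lambda>j. v j + (\<Sum>l\<in>{..<N} - S. ?c l j * v l)"
  have "?d j = 0"
  proof (rule gram_kernel_trivial[OF rank _ \<open>j \<in> S\<close>])
    fix k assume k: "k \<in> S"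
    have "cdot n (\<lambda>i. A i k) (\<lambda>i. \<Sum>m\<in>S. A i m * ?d m)
       = cdot n (\<lambda>i. A i k) (\<lambda>i. (\<Sum>j<N. A i j * v j) -
           (\<Sum>l\<in>{..<N} - S. v l * (A i l - (\<Sum>m\<in>S. A i m * ?c l m))))"
    proof (intro arg_cong[of _ _ "cdot n (\<lambda>i. A i k)"] ext)
      fix i
      have "(\<Sum>m\<in>S. A i m * ?d m) = (\<Sum>m\<in>S. A i m * v m) + (\<Sum>m\<in>S. \<Sum>l\<in>{..<N} - S. A i m * (?c l m * v l))"
        by (simp add: algebra_simps sum.distrib sum_distrib_left)
      also have "(\<Sum>m\<in>S. \<Sum>l\<in>{..<N} - S. A i m * (?c l m * v l)) = (\<Sum>l\<in>{..<N} - S. \<Sum>m\<in>S. A i m * (?c l m * v l))"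
        by (rule sum.swap)
      also have "(\<Sum>m\<in>S. A i m * v m) = (\<Sum>j<N. A i j * v j) - (\<Sum>l\<in>{..<N} - S. A i l * v l)"
        using sum.subset_diff[OF S, of "\<lambda>j. A i j * v j"] by simp
      finally show "(\<Sum>m\<in>S. A i m * ?d m) = (\<Sum>j<N. A i j * v j) -
           (\<Sum>l\<in>{..<N} - S. v l * (A i l - (\<Sum>m\<in>S. A i m * ?c l m)))"
        by (simp add: algebra_simps sum_subtractf sum_distrib_left)
    qed
    also have "\<dots> = 0"
      unfolding cdot_diff[of n _ "\<lambda>i. \<Sum>j<N. A i j * v j"] cdot_sum[of n _ _ "{..<N} - S"] cdot_scale
        pinv_apply_orthogonal[OF fin rank k]
      using ker by (simp add: cdot_zero_right)
    finally show "cdot n (\<lambda>i. A i k) (\<lambda>i. \<Sum>m\<in>S. A i m * ?d m) = 0" .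
  qed
  then show ?thesis by (simp add: add_eq_0_iff)
qed

section \<open>Row norms and the certificate for uniqueness\<close>

lemma vnorm2_L2_set: "vnorm2 I c = L2_set (\<lambda>j. norm (c j)) I"
  by (simp add: vnorm2_def L2_set_def)

lemma vnorm2_nonneg [simp]: "0 \<le> vnorm2 I c"
  by (simp add: vnorm2_def sum_nonneg)

lemma vnorm2_eq_0: "finite I \<Longrightarrow> vnorm2 I c = 0 \<longleftrightarrow> (\<forall>j\<in>I. c j = 0)"
  by (simp add: vnorm2_L2_set L2_set_eq_0_iff)

lemma vnorm2_square: "(vnorm2 I c)\<^sup>2 = (\<Sum>j\<in>I. (norm (c j))\<^sup>2)"
  by (simp add: vnorm2_def sum_nonneg)

lemma Re_cdot_le: "Re (cdot L u v) \<le> vnorm2 {..<L} u * vnorm2 {..<L} v"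
proof -
  have "Re (cdot L u v) \<le> norm (cdot L u v)" by (rule complex_Re_le_cmod)
  also have "\<dots> \<le> (\<Sum>t<L. \<bar>norm (u t)\<bar> * \<bar>norm (v t)\<bar>)"
    unfolding cdot_def by (rule order_trans[OF norm_sum]) (simp add: norm_mult)
  also have "\<dots> \<le> vnorm2 {..<L} u * vnorm2 {..<L} v"
    unfolding vnorm2_L2_set by (rule L2_set_mult_ineq)
  finally show ?thesis .
qed

text \<open>The rows of \<open>sg\<close> are subgradients of the row norms at \<open>X\<close>; a row of \<open>X\<close> that vanishes
  is allowed, with the subgradient \<open>0\<close>.\<close>

lemma unique_l21_solutionI:
  assumes S: "S \<subseteq> {..<N}" and rank: "full_col_rank n A S"
    and X: "X \<in> cmats N L" and X0: "\<And>j t. j \<notin> S \<Longrightarrow> X j t = 0"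
    and sg1: "\<And>j. j \<in> S \<Longrightarrow> vnorm2 {..<L} (sg j) \<le> 1"
    and sgX: "\<And>j. j \<in> S \<Longrightarrow> Re (cdot L (sg j) (X j)) = vnorm2 {..<L} (X j)"
    and dual: "\<And>l. l < N \<Longrightarrow> l \<notin> S \<Longrightarrow>
      vnorm2 {..<L} (\<lambda>t. \<Sum>j\<in>S. cnj (pinv_apply n A S (\<lambda>i. A i l) j) * sg j t) < 1"
  shows "unique_l21_solution n N L A X"
  unfolding unique_l21_solution_def
proof (intro conjI ballI impI)
  fix Z assume Z: "Z \<in> cmats N L"
    and as: "(\<forall>i<n. \<forall>t<L. matmul N A Z i t = matmul N A X i t) \<and> Z \<noteq> X"
  let ?c = "\<lambda>l. pinv_apply n A S (\<lambda>i. A i l)"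
  let ?S' = "{..<N} - S"
  let ?w = "\<lambda>l t. \<Sum>j\<in>S. cnj (?c l j) * sg j t"
  define V where "V = (\<lambda>j t. Z j t - X j t)"
  have VS: "V j t = - (\<Sum>l\<in>?S'. ?c l j * V l t)" if "j \<in> S" "t < L" for j t
    by (rule kernel_rows_on_support[OF S rank _ \<open>j \<in> S\<close>])
      (use as \<open>t < L\<close> in \<open>auto simp: V_def matmul_def algebra_simps sum_subtractf\<close>)
  \<comment> \<open>The rows of \<open>V\<close> outside \<open>S\<close> determine those on
    \<open>S\<close>; if they all vanished, \<open>Z\<close> would equal \<open>X\<close>.\<close>
  have "\<exists>l\<in>?S'. vnorm2 {..<L} (V l) \<noteq> 0"
  proof (rule ccontr)
    assume "\<not> ?thesis"
    then have V0: "V l t = 0" if "l \<in> ?S'" "t < L" for l t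
      using that by (auto simp: vnorm2_eq_0)
    then have "V j t = 0" if "j \<in> S" "t < L" for j t
      using VS[OF that] that by simp
    then have "V j t = 0" if "j < N" "t < L" for j t
      using V0 that by (cases "j \<in> S") auto
    then have "Z j t = X j t" for j t
      using Z X by (cases "j < N \<and> t < L") (auto simp: V_def cmats_def)
    then have "Z = X" by (intro ext)
    then show False using as by simp
  qed
  then obtain l0 where l0: "l0 \<in> ?S'" "vnorm2 {..<L} (V l0) > 0"
    using vnorm2_nonneg[of "{..<L}"] by (auto simp: less_le)
  \<comment> \<open>Subgradient inequality for the row norm at \<open>X j\<close>, from
    Cauchy-Schwarz and \<open>sgX\<close>.\<close>
  have row: "vnorm2 {..<L} (Z j) \<ge> vnorm2 {..<L} (X j) + Re (cdot L (sg j) (V j))" if "j \<in> S" for j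
  proof -
    have "Re (cdot L (sg j) (Z j)) \<le> vnorm2 {..<L} (sg j) * vnorm2 {..<L} (Z j)" by (rule Re_cdot_le)
    also have "\<dots> \<le> 1 * vnorm2 {..<L} (Z j)" by (intro mult_right_mono sg1 that) simp
    finally show ?thesis using sgX[OF that] by (simp add: V_def cdot_diff)
  qed
  \<comment> \<open>Substituting \<open>VS\<close> moves the first-order change on \<open>S\<close>
    to the rows outside \<open>S\<close>, where it is paired with the dual rows \<open>?w l\<close>
    of norm below 1.\<close>
  have sw: "(\<Sum>j\<in>S. cdot L (sg j) (V j)) = - (\<Sum>l\<in>?S'. cdot L (?w l) (V l))"
  proof -
    have "(\<Sum>j\<in>S. cdot L (sg j) (V j)) = (\<Sum>j\<in>S. - cdot L (sg j) (\<lambda>t. \<Sum>l\<in>?S'. ?c l j * V l t))"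
    proof (rule sum.cong)
      fix j assume "j \<in> S"
      then have "cdot L (sg j) (V j) = cdot L (sg j) (\<lambda>t. - 1 * (\<Sum>l\<in>?S'. ?c l j * V l t))"
        unfolding cdot_def using VS by (intro sum.cong) simp_all
      then show "cdot L (sg j) (V j) = - cdot L (sg j) (\<lambda>t. \<Sum>l\<in>?S'. ?c l j * V l t)"
        unfolding cdot_scale by simp
    qed simp
    also have "\<dots> = - (\<Sum>j\<in>S. \<Sum>l\<in>?S'. ?c l j * cdot L (sg j) (V l))"
      unfolding cdot_sum cdot_scale by (simp add: sum_negf)
    also have "\<dots> = - (\<Sum>l\<in>?S'. \<Sum>j\<in>S. ?c l j * cdot L (sg j) (V l))"
      by (subst sum.swap) simp
    also have "\<dots> = - (\<Sum>l\<in>?S'. cdot L (?w l) (V l))"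
      unfolding cdot_sum_left cdot_scale_left by simp
    finally show ?thesis .
  qed
  \<comment> \<open>For a vanishing row of \<open>V\<close> the comparison is an equality;
    strictness comes from \<open>l0\<close>.\<close>
  have "(\<Sum>l\<in>?S'. Re (cdot L (?w l) (V l))) < (\<Sum>l\<in>?S'. vnorm2 {..<L} (V l))"
  proof (rule sum_strict_mono_ex1)
    have b: "Re (cdot L (?w l) (V l)) \<le> vnorm2 {..<L} (?w l) * vnorm2 {..<L} (V l)" for l
      by (rule Re_cdot_le)
    show "\<forall>l\<in>?S'. Re (cdot L (?w l) (V l)) \<le> vnorm2 {..<L} (V l)"
    proof
      fix l assume "l \<in> ?S'"
      then have "vnorm2 {..<L} (?w l) * vnorm2 {..<L} (V l) \<le> 1 * vnorm2 {..<L} (V l)"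
        using dual[of l] by (intro mult_right_mono) auto
      with b[of l] show "Re (cdot L (?w l) (V l)) \<le> vnorm2 {..<L} (V l)" by linarith
    qed
    have "vnorm2 {..<L} (?w l0) * vnorm2 {..<L} (V l0) < 1 * vnorm2 {..<L} (V l0)"
      using dual[of l0] l0 by (intro mult_strict_right_mono) auto
    then show "\<exists>l\<in>?S'. Re (cdot L (?w l) (V l)) < vnorm2 {..<L} (V l)"
      using b[of l0] l0(1) by (intro bexI[of _ l0]) auto
  qed simp
  then have "(\<Sum>j\<in>S. Re (cdot L (sg j) (V j))) + (\<Sum>l\<in>?S'. vnorm2 {..<L} (V l)) > 0"
    using arg_cong[OF sw, of Re] by simp
  moreover have "norm21 N L X = (\<Sum>j\<in>S. vnorm2 {..<L} (X j))"
    unfolding norm21_def using S X0 by (intro sum.mono_neutral_right) (auto simp: vnorm2_def)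
  moreover have "norm21 N L Z = (\<Sum>j\<in>S. vnorm2 {..<L} (Z j)) + (\<Sum>l\<in>?S'. vnorm2 {..<L} (V l))"
  proof -
    have "norm21 N L Z = (\<Sum>l\<in>?S'. vnorm2 {..<L} (Z l)) + (\<Sum>j\<in>S. vnorm2 {..<L} (Z j))"
      unfolding norm21_def by (rule sum.subset_diff[OF S]) simp
    also have "(\<Sum>l\<in>?S'. vnorm2 {..<L} (Z l)) = (\<Sum>l\<in>?S'. vnorm2 {..<L} (V l))"
      using X0 by (intro sum.cong) (auto simp: V_def vnorm2_def)
    finally show ?thesis by simp
  qed
  moreover have "(\<Sum>j\<in>S. vnorm2 {..<L} (Z j)) \<ge> (\<Sum>j\<in>S. vnorm2 {..<L} (X j)) + (\<Sum>j\<in>S. Re (cdot L (sg j) (V j)))"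
    unfolding sum.distrib[symmetric] by (rule sum_mono) (rule row)
  ultimately show "norm21 N L X < norm21 N L Z" by linarith
qed (rule X)

section \<open>Measurability of the recovery event\<close>

text \<open>This removes an uncountable union: with slack \<open>1 / Suc m\<close> a countable dense
  subset of \<open>K\<close> suffices by continuity, and compactness turns arbitrarily small slack
  into a minimiser with value at most 0.\<close>

lemma sets_Ex_compact_le:
  fixes K :: "'b::{metric_space, second_countable_topology} set" and f :: "'a \<Rightarrow> 'b \<Rightarrow> real"
  assumes K: "compact K"
    and cont: "\<And>x. x \<in> space M \<Longrightarrow> continuous_on K (f x)"
    and meas[measurable]: "\<And>V. V \<in> K \<Longrightarrow> (\<lambda>x. f x V) \<in> borel_measurable M"
  shows "{x \<in> space M. \<exists>V\<in>K. f x V \<le> 0} \<in> sets M"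
proof -
  obtain T where T: "countable T" "T \<subseteq> K" "K \<subseteq> closure T" using separable by blast
  have "(\<exists>V\<in>K. f x V \<le> 0) \<longleftrightarrow> (\<forall>m::nat. \<exists>V\<in>T. f x V < 1 / Suc m)" if x: "x \<in> space M" for x
  proof
    assume "\<exists>V\<in>K. f x V \<le> 0"
    then obtain V where V: "V \<in> K" "f x V \<le> 0" by blast
    show "\<forall>m::nat. \<exists>V\<in>T. f x V < 1 / Suc m"
    proof
      fix m :: nat
      obtain d where d: "d > 0" "\<And>W. W \<in> K \<Longrightarrow> dist W V < d \<Longrightarrow> dist (f x W) (f x V) < 1 / Suc m"
        using cont[OF x] V(1) unfolding continuous_on_iff by (metis of_nat_0_less_iff zero_less_Suc zero_less_divide_1_iff)
      obtain W where "W \<in> T" "dist W V < d"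
        using T(3) V(1) d(1) by (meson closure_approachable subsetD)
      with d(2)[of W] T(2) V(2) show "\<exists>V\<in>T. f x V < 1 / Suc m"
        by (intro bexI[of _ W]) (auto simp: dist_real_def)
    qed
  next
    assume ap: "\<forall>m::nat. \<exists>V\<in>T. f x V < 1 / Suc m"
    then have "K \<noteq> {}" using T(2) by blast
    then obtain V where V: "V \<in> K" "\<And>W. W \<in> K \<Longrightarrow> f x V \<le> f x W"
      using continuous_attains_inf[OF K _ cont[OF x]] by blast
    have "f x V \<le> 0"
    proof (rule ccontr)
      assume "\<not> f x V \<le> 0"
      then obtain m :: nat where "1 / Suc m < f x V" using nat_approx_posE by (metis not_le of_nat_Suc)
      then show False using ap V(2) T(2) by (meson less_le_trans not_less order_less_imp_le subsetD)
    qed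
    then show "\<exists>V\<in>K. f x V \<le> 0" using V(1) by blast
  qed
  then have eq: "{x \<in> space M. \<exists>V\<in>K. f x V \<le> 0} = {x \<in> space M. \<forall>m::nat. \<exists>V\<in>T. f x V < 1 / Suc m}"
    by blast
  have "{x \<in> space M. f x V < 1 / Suc m} \<in> sets M" if "V \<in> T" for V and m :: nat
  proof -
    have [measurable]: "(\<lambda>x. f x V) \<in> borel_measurable M" using that T(2) meas by blast
    show ?thesis by measurable
  qed
  then have "{x \<in> space M. \<exists>V\<in>T. f x V < 1 / Suc m} \<in> sets M" for m :: nat
    using T(1) by (intro sets.sets_Collect_countable_Ex') auto
  then show ?thesis unfolding eq by (intro sets.sets_Collect_countable_All)
qed

section \<open>Compact shells of the kernel\<close>

lemma continuous_on_entry: "continuous_on UNIV (\<lambda>V::nat \<Rightarrow> nat \<Rightarrow> complex. V j t)"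
  by (rule continuous_on_product_then_coordinatewise[OF continuous_on_product_coordinates])

lemma continuous_on_norm21_add:
  "continuous_on UNIV (\<lambda>V. norm21 N L (\<lambda>j t. X j t + V j t))"
  unfolding norm21_def vnorm2_def
  by (intro continuous_on_sum continuous_on_real_sqrt continuous_on_power continuous_on_norm continuous_on_add
      continuous_on_const continuous_on_entry)

text \<open>Matrices are functions on all of \<open>nat\<close>, so compactness comes from
  Tychonoff's theorem, applied once to the entries of a row and once to the rows; \<open>fin\<close>
  is polymorphic for this reason.\<close>

lemma compact_bounded_entries: "compact {V::nat \<Rightarrow> nat \<Rightarrow> complex. \<forall>j t. norm (V j t) \<le> r}"
proof -
  have fin: "compact (PiE UNIV B)" if "\<And>i. compact (B i)" for B :: "nat \<Rightarrow> 'b::topological_space set"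
  proof -
    have "compactin (product_topology (\<lambda>i. euclidean) UNIV) (PiE UNIV B)"
      using that by (simp add: compactin_PiE)
    then show ?thesis by (simp add: euclidean_product_topology)
  qed
  have "compact (PiE UNIV (\<lambda>j::nat. PiE UNIV (\<lambda>t::nat. cball (0::complex) r)))"
    by (intro fin compact_cball)
  also have "PiE UNIV (\<lambda>j::nat. PiE UNIV (\<lambda>t::nat. cball (0::complex) r)) = {V. \<forall>j t. norm (V j t) \<le> r}"
    by (auto simp: PiE_iff)
  finally show ?thesis .
qed

lemma norm_entry_le_norm21:
  assumes "j < N" "t < L" shows "norm (V j t) \<le> norm21 N L V"
proof -
  have "norm (V j t) \<le> vnorm2 {..<L} (V j)"
    unfolding vnorm2_L2_set using assms member_le_L2_set[of "{..<L}" t "\<lambda>t. norm (V j t)"] by simp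
  also have "\<dots> \<le> norm21 N L V"
    unfolding norm21_def using assms by (intro member_le_sum) auto
  finally show ?thesis .
qed

text \<open>The shells exhaust the nonzero kernel matrices. The lower bound excludes 0 by a closed
  condition, and the upper bound together with \<open>cmats\<close> confines every
  coordinate.\<close>

definition kernel_shell :: "nat \<Rightarrow> nat \<Rightarrow> nat \<Rightarrow> (nat \<Rightarrow> nat \<Rightarrow> complex) \<Rightarrow> nat \<Rightarrow> (nat \<Rightarrow> nat \<Rightarrow> complex) set" where
  "kernel_shell n N L A m = {V \<in> cmats N L. (\<forall>i<n. \<forall>t<L. matmul N A V i t = 0) \<and>
     1 / Suc m \<le> norm21 N L V \<and> norm21 N L V \<le> Suc m}"

lemma compact_kernel_shell: "compact (kernel_shell n N L A m)"
proof -
  have "closed {V::nat \<Rightarrow> nat \<Rightarrow> complex. (\<forall>j t. (N \<le> j \<or> L \<le> t) \<longrightarrow> V j t = 0) \<and> (\<forall>i<n. \<forall>t<L. (\<Sum>j<N. A i j * V j t) = 0) \<and>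
     1 / Suc m \<le> norm21 N L V \<and> norm21 N L V \<le> Suc m}"
    using continuous_on_norm21_add[of N L "\<lambda>_ _. 0"]
    by (intro closed_Collect_conj closed_Collect_all closed_Collect_imp closed_Collect_eq closed_Collect_le
        open_Collect_const continuous_intros continuous_on_entry) simp_all
  then have cl: "closed (kernel_shell n N L A m)"
    by (simp add: kernel_shell_def cmats_def matmul_def)
  have sub: "kernel_shell n N L A m \<subseteq> {V. \<forall>j t. norm (V j t) \<le> Suc m}"
  proof (intro subsetI CollectI allI)
    fix V j t assume V: "V \<in> kernel_shell n N L A m"
    show "norm (V j t) \<le> Suc m"
    proof (cases "j < N \<and> t < L")
      case True
      then show ?thesis using norm_entry_le_norm21[of j N t L V] V by (simp add: kernel_shell_def)
    next
      case False
      then have "V j t = 0" using V by (auto simp: kernel_shell_def cmats_def)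
      then show ?thesis by simp
    qed
  qed
  show ?thesis using compact_Int_closed[OF compact_bounded_entries[of "Suc m"] cl] sub
    by (simp add: Int_absorb1)
qed

text \<open>Competitors are \<open>X + V\<close> with \<open>V\<close> a nonzero kernel matrix, and
  each such \<open>V\<close> lies in some shell. The quantifier over competitors thus becomes
  countably many existence statements over compact sets.\<close>

lemma unique_l21_solution_iff:
  assumes X: "X \<in> cmats N L"
  shows "unique_l21_solution n N L A X \<longleftrightarrow>
    (\<forall>m. \<not> (\<exists>V\<in>kernel_shell n N L A m. norm21 N L (\<lambda>j t. X j t + V j t) - norm21 N L X \<le> 0))"
proof
  assume u: "unique_l21_solution n N L A X"
  show "\<forall>m. \<not> (\<exists>V\<in>kernel_shell n N L A m. norm21 N L (\<lambda>j t. X j t + V j t) - norm21 N L X \<le> 0)"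
  proof (intro allI notI)
    fix m assume "\<exists>V\<in>kernel_shell n N L A m. norm21 N L (\<lambda>j t. X j t + V j t) - norm21 N L X \<le> 0"
    then obtain V where V: "V \<in> kernel_shell n N L A m" "norm21 N L (\<lambda>j t. X j t + V j t) \<le> norm21 N L X" by auto
    let ?Z = "\<lambda>j t. X j t + V j t"
    have "?Z \<in> cmats N L" using X V by (auto simp: kernel_shell_def cmats_def)
    moreover have "\<forall>i<n. \<forall>t<L. matmul N A ?Z i t = matmul N A X i t"
      using V by (simp add: kernel_shell_def matmul_def algebra_simps sum.distrib)
    moreover have "?Z \<noteq> X"
    proof
      assume "?Z = X"
      then have "V j t = 0" for j t using fun_cong[of ?Z X j, THEN fun_cong, of t] by simp
      then have "norm21 N L V = 0" by (simp add: norm21_def vnorm2_def)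
      moreover have "0 < 1 / real (Suc m)" by simp
      ultimately show False using V(1) unfolding kernel_shell_def by auto
    qed
    ultimately show False using u V(2) unfolding unique_l21_solution_def by (meson not_le)
  qed
next
  assume as: "\<forall>m. \<not> (\<exists>V\<in>kernel_shell n N L A m. norm21 N L (\<lambda>j t. X j t + V j t) - norm21 N L X \<le> 0)"
  show "unique_l21_solution n N L A X"
    unfolding unique_l21_solution_def
  proof (intro conjI ballI impI X)
    fix Z assume Z: "Z \<in> cmats N L" and ZX: "(\<forall>i<n. \<forall>t<L. matmul N A Z i t = matmul N A X i t) \<and> Z \<noteq> X"
    let ?V = "\<lambda>j t. Z j t - X j t"
    obtain j t where jt: "Z j t \<noteq> X j t" using ZX by (auto simp: fun_eq_iff)
    then have "j < N \<and> t < L" using Z X unfolding cmats_def by (cases "j < N \<and> t < L") auto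
    then have "0 < norm (?V j t)" "norm (?V j t) \<le> norm21 N L ?V"
      using jt norm_entry_le_norm21[of j N t L ?V] by auto
    then have pos: "norm21 N L ?V > 0" by linarith
    obtain m1 :: nat where m1: "1 / Suc m1 < norm21 N L ?V" using nat_approx_posE[OF pos] by auto
    obtain m2 :: nat where m2: "norm21 N L ?V < m2" using reals_Archimedean2 by blast
    define m where "m = max m1 m2"
    have "1 / Suc m \<le> 1 / Suc m1" unfolding m_def by (intro divide_left_mono) auto
    then have "1 / Suc m \<le> norm21 N L ?V" using m1 by linarith
    moreover have "norm21 N L ?V \<le> Suc m" using m2 unfolding m_def by linarith
    moreover have "?V \<in> cmats N L" using Z X by (auto simp: cmats_def)
    moreover have "\<forall>i<n. \<forall>t<L. matmul N A ?V i t = 0"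
      using ZX by (simp add: matmul_def algebra_simps sum_subtractf)
    ultimately have "?V \<in> kernel_shell n N L A m" unfolding kernel_shell_def by blast
    then show "norm21 N L X < norm21 N L Z" using as by fastforce
  qed
qed

lemma sets_unique_l21_solution:
  assumes R: "sets R = sets (PiM {..<L} (\<lambda>_. borel))" and S: "S \<subseteq> {..<N}"
    and emb[measurable]: "emb \<in> borel \<rightarrow>\<^sub>M borel"
  shows "{\<Phi> \<in> space (rows_model S R). unique_l21_solution n N L A (signal_mat S L \<sigma> emb \<Phi>)} \<in> sets (rows_model S R)"
proof -
  let ?X = "signal_mat S L \<sigma> emb"
  let ?P = "rows_model S R"
  have X: "?X \<Phi> \<in> cmats N L" for \<Phi> using S by (auto simp: cmats_def signal_mat_def)
  have [measurable]: "(\<lambda>\<Phi>. ?X \<Phi> j t) \<in> borel_measurable ?P" for j t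
  proof (cases "j \<in> S \<and> t < L")
    case True
    have "(\<lambda>\<Phi>. \<Phi> j) \<in> ?P \<rightarrow>\<^sub>M R"
      unfolding rows_model_def using True by (intro measurable_component_singleton) simp
    also have "(?P \<rightarrow>\<^sub>M R) = (?P \<rightarrow>\<^sub>M PiM {..<L} (\<lambda>_. borel))" by (intro measurable_cong_sets refl R)
    finally have "(\<lambda>\<Phi>. \<Phi> j t) \<in> borel_measurable ?P"
      by (rule measurable_compose) (use True in \<open>intro measurable_component_singleton, simp\<close>)
    then show ?thesis using True by (simp add: signal_mat_def)
  next
    case False
    then show ?thesis by (auto simp: signal_mat_def)
  qed
  have [measurable]: "(\<lambda>\<Phi>. norm21 N L (\<lambda>j t. ?X \<Phi> j t + V j t)) \<in> borel_measurable ?P"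
    "(\<lambda>\<Phi>. norm21 N L (?X \<Phi>)) \<in> borel_measurable ?P" for V
    unfolding norm21_def vnorm2_def by measurable
  have "{\<Phi> \<in> space ?P. \<exists>V\<in>kernel_shell n N L A m.
      norm21 N L (\<lambda>j t. ?X \<Phi> j t + V j t) - norm21 N L (?X \<Phi>) \<le> 0} \<in> sets ?P" for m
  proof (rule sets_Ex_compact_le[OF compact_kernel_shell])
    show "continuous_on (kernel_shell n N L A m) (\<lambda>V. norm21 N L (\<lambda>j t. ?X \<Phi> j t + V j t) - norm21 N L (?X \<Phi>))" for \<Phi>
      by (intro continuous_on_diff continuous_on_const continuous_on_subset[OF continuous_on_norm21_add] subset_UNIV)
  qed measurable
  then show ?thesis
    unfolding unique_l21_solution_iff[OF X]
    by (intro sets.sets_Collect_countable_All sets.sets_Collect_neg)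
qed

section \<open>Directions\<close>

abbreviation vscale :: "nat \<Rightarrow> real \<Rightarrow> (nat \<Rightarrow> 'a::real_vector) \<Rightarrow> nat \<Rightarrow> 'a" where
  "vscale L c x \<equiv> restrict (\<lambda>t. c *\<^sub>R x t) {..<L}"

text \<open>At the zero vector \<open>1 / 0 = 0\<close> yields the zero vector: the length is then 0
  instead of 1, but idempotence and oddness persist.\<close>

definition direction :: "nat \<Rightarrow> (nat \<Rightarrow> 'a::real_normed_vector) \<Rightarrow> nat \<Rightarrow> 'a" where
  "direction L x = vscale L (1 / vnorm2 {..<L} x) x"

text \<open>For complex entries this is the real part of the Hermitian product, so vectors are
  treated as elements of a real space of dimension \<open>L * DIM('a)\<close>.\<close>

definition vinner :: "nat \<Rightarrow> (nat \<Rightarrow> 'a::real_inner) \<Rightarrow> (nat \<Rightarrow> 'a) \<Rightarrow> real" where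
  "vinner L x h = (\<Sum>t<L. x t \<bullet> h t)"

lemma vnorm2_cong: "(\<And>t. t \<in> I \<Longrightarrow> norm (x t) = norm (y t)) \<Longrightarrow> vnorm2 I x = vnorm2 I y"
  by (simp add: vnorm2_def)

lemma vnorm2_scale: "vnorm2 I (\<lambda>t. c *\<^sub>R x t) = \<bar>c\<bar> * vnorm2 I x"
  by (simp add: vnorm2_def power_mult_distrib sum_distrib_left[symmetric] real_sqrt_mult)

lemma vnorm2_vscale: "vnorm2 {..<L} (vscale L c x) = \<bar>c\<bar> * vnorm2 {..<L} x"
  by (subst vnorm2_scale[symmetric]) (rule vnorm2_cong, simp)

lemma vnorm2_square_inner: "(vnorm2 {..<L} x)\<^sup>2 = vinner L x x"
  by (simp add: vnorm2_square vinner_def power2_norm_eq_inner)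

lemma vinner_vscale: "vinner L (vscale L c x) h = c * vinner L x h"
  by (simp add: vinner_def sum_distrib_left)

lemma vinner_uminus: "vinner L (vscale L (-1) x) h = - vinner L x h"
  by (simp only: vinner_vscale mult_minus1)

lemma vinner_direction: "vinner L x h = vnorm2 {..<L} x * vinner L (direction L x) h"
proof (cases "vnorm2 {..<L} x = 0")
  case True
  then show ?thesis by (simp add: vnorm2_eq_0 vinner_def)
next
  case False
  then show ?thesis unfolding direction_def vinner_vscale by simp
qed

lemma vnorm2_direction_le: "vnorm2 {..<L} (direction L x) \<le> 1"
  by (simp add: direction_def vnorm2_vscale)

lemma direction_vscale: "c > 0 \<Longrightarrow> direction L (vscale L c x) = direction L x"
  unfolding direction_def vnorm2_vscale by (auto simp: fun_eq_iff)

lemma direction_uminus: "direction L (vscale L (-1) x) = vscale L (-1) (direction L x)"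
  unfolding direction_def vnorm2_vscale by (auto simp: fun_eq_iff)

lemma direction_direction: "direction L (direction L x) = direction L x"
proof (cases "vnorm2 {..<L} x = 0")
  case True
  then show ?thesis by (auto simp: direction_def fun_eq_iff)
next
  case False
  then have "1 / vnorm2 {..<L} x > 0" by (simp add: less_le)
  from direction_vscale[OF this, of L x] show ?thesis by (simp only: direction_def[of L x, symmetric])
qed

lemma vinner_le: "\<bar>vinner L x h\<bar> \<le> vnorm2 {..<L} x * vnorm2 {..<L} h"
proof -
  have "\<bar>vinner L x h\<bar> \<le> (\<Sum>t<L. \<bar>norm (x t)\<bar> * \<bar>norm (h t)\<bar>)"
    unfolding vinner_def by (rule order_trans[OF sum_abs]) (simp add: sum_mono Cauchy_Schwarz_ineq2)
  also have "\<dots> \<le> vnorm2 {..<L} x * vnorm2 {..<L} h"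
    unfolding vnorm2_L2_set by (rule L2_set_mult_ineq)
  finally show ?thesis .
qed

text \<open>Tangent at \<open>u = 1\<close> of \<open>u \<mapsto> cosh (q * sqrt u)\<close>, read at
  \<open>u = v^2\<close>; its slope is \<open>q * sinh q / 2\<close>. For \<open>q \<ge> 0\<close>
  the derivative in \<open>v\<close> of the difference has the sign of
  \<open>sinh (q * v) - v * sinh q\<close>, which changes at \<open>v = 1\<close>; negative
  \<open>q\<close> follows by evenness.\<close>

lemma cosh_tangent: 
  fixes q v :: real
  assumes v: "v \<ge> 0"
  shows "cosh q + q * sinh q / 2 * (v\<^sup>2 - 1) \<le> cosh (q * v)"
proof -
  have conv: "v * sinh q \<le> sinh (q * v)" if "1 \<le> v" "0 \<le> q" for q v :: real
  proof -
    let ?f = "\<lambda>q. sinh (q * v) - v * sinh q"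
    have "?f 0 \<le> ?f q"
    proof (rule DERIV_nonneg_imp_nondecreasing[OF \<open>0 \<le> q\<close>])
      fix x :: real assume x: "0 \<le> x" "x \<le> q"
      have "(?f has_real_derivative (cosh (x * v) * v - v * cosh x)) (at x)"
        by (auto intro!: derivative_eq_intros)
      moreover have "cosh x \<le> cosh (x * v)"
        using x that by (subst cosh_real_nonneg_le_iff) (auto simp: mult_le_cancel_left1)
      then have "0 \<le> cosh (x * v) * v - v * cosh x" using that by simp
      ultimately show "\<exists>y. (?f has_real_derivative y) (at x) \<and> 0 \<le> y" by blast
    qed
    then show ?thesis by simp
  qed
  \<comment> \<open>This is \<open>conv\<close> with factor \<open>1 / v\<close> at the point
    \<open>q * v\<close>.\<close>
  have conc: "sinh (q * v) \<le> v * sinh q" if "0 \<le> v" "v \<le> 1" "0 \<le> q" for q v :: real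
  proof (cases "v = 0")
    case False
    then show ?thesis using conv[of "1 / v" "q * v"] that by (simp add: field_simps)
  qed simp
  have pos: "cosh q + q * sinh q / 2 * (v\<^sup>2 - 1) \<le> cosh (q * v)" if q: "0 \<le> q" for q
  proof -
    let ?f = "\<lambda>v. cosh (q * v) - q * sinh q / 2 * (v\<^sup>2 - 1)"
    have der: "(?f has_real_derivative (q * (sinh (q * x) - x * sinh q))) (at x)" for x
      by (auto intro!: derivative_eq_intros simp: algebra_simps)
    have "?f 1 \<le> ?f v"
    proof (cases "v \<ge> 1")
      case True
      show ?thesis
      proof (rule DERIV_nonneg_imp_nondecreasing[OF True])
        fix x :: real assume "1 \<le> x" "x \<le> v"
        then have "0 \<le> q * (sinh (q * x) - x * sinh q)"
          using conv[OF _ q, of x] q by (intro mult_nonneg_nonneg) auto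
        with der show "\<exists>y. (?f has_real_derivative y) (at x) \<and> 0 \<le> y" by blast
      qed
    next
      case False
      then have "v \<le> 1" by simp
      then show ?thesis
      proof (rule DERIV_nonpos_imp_nonincreasing)
        fix x :: real assume "v \<le> x" "x \<le> 1"
        then have "q * (sinh (q * x) - x * sinh q) \<le> 0"
          using conc[OF _ _ q, of x] q v by (intro mult_nonneg_nonpos) auto
        with der show "\<exists>y. (?f has_real_derivative y) (at x) \<and> y \<le> 0" by blast
      qed
    qed
    then show ?thesis by simp
  qed
  show ?thesis
  proof (cases "q \<ge> 0")
    case False
    then show ?thesis using pos[of "- q"] by simp
  qed (rule pos)
qed

section \<open>The Gaussian weight\<close>

interpretation lborel_product: product_sigma_finite "\<lambda>_. lborel :: 'a::euclidean_space measure"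
  by standard

text \<open>A product measure is determined by rectangles, and there the claim is the one-factor
  formula in each coordinate; its Jacobian \<open>\<bar>c\<bar> ^ DIM('a)\<close> occurs
  \<open>L\<close> times.\<close>

lemma lebesgue_vec_affine:
  fixes y :: "nat \<Rightarrow> 'a::euclidean_space"
  assumes c: "c \<noteq> 0"
  shows "density (distr (lebesgue_vec L) (lebesgue_vec L) (\<lambda>x. \<lambda>t\<in>{..<L}. y t + c *\<^sub>R x t))
    (\<lambda>_. ennreal (\<bar>c\<bar> ^ (L * DIM('a)))) = lebesgue_vec L"
proof (rule lborel_product.PiM_eqI)
  let ?T = "\<lambda>x. \<lambda>t\<in>{..<L}. y t + c *\<^sub>R x t"
  let ?M = "lebesgue_vec L :: (nat \<Rightarrow> 'a) measure"
  have T[measurable]: "?T \<in> ?M \<rightarrow>\<^sub>M ?M" by measurable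
  fix A :: "nat \<Rightarrow> 'a set" assume A: "\<And>i. i \<in> {..<L} \<Longrightarrow> A i \<in> sets lborel"
  have PA: "Pi\<^sub>E {..<L} A \<in> sets ?M" using A by (intro sets_PiM_I_finite) auto
  have one: "emeasure lborel (A t) = ennreal (\<bar>c\<bar> ^ DIM('a)) * emeasure lborel ((\<lambda>x. y t + c *\<^sub>R x) -` A t)"
    if "t < L" for t
  proof -
    have At: "A t \<in> sets borel" using A that by simp
    have "emeasure lborel (A t) = emeasure (density (distr lborel borel (\<lambda>x. y t + c *\<^sub>R x)) (\<lambda>_. ennreal (\<bar>c\<bar> ^ DIM('a)))) (A t)"
      using lborel_affine[OF c, of "y t"] by simp
    also have "\<dots> = ennreal (\<bar>c\<bar> ^ DIM('a)) * emeasure lborel ((\<lambda>x. y t + c *\<^sub>R x) -` A t)"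
      using At by (simp add: emeasure_density nn_integral_cmult emeasure_distr)
    finally show ?thesis .
  qed
  have eq: "?T -` Pi\<^sub>E {..<L} A \<inter> space ?M = Pi\<^sub>E {..<L} (\<lambda>t. (\<lambda>x. y t + c *\<^sub>R x) -` A t)"
    by (auto simp: space_PiM PiE_iff extensional_def)
  have "emeasure (density (distr ?M ?M ?T) (\<lambda>_. ennreal (\<bar>c\<bar> ^ (L * DIM('a))))) (Pi\<^sub>E {..<L} A)
    = ennreal (\<bar>c\<bar> ^ (L * DIM('a))) * emeasure ?M (Pi\<^sub>E {..<L} (\<lambda>t. (\<lambda>x. y t + c *\<^sub>R x) -` A t))"
    using PA by (simp add: emeasure_density nn_integral_cmult emeasure_distr eq)
  also have "emeasure ?M (Pi\<^sub>E {..<L} (\<lambda>t. (\<lambda>x. y t + c *\<^sub>R x) -` A t)) =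
      (\<Prod>t<L. emeasure lborel ((\<lambda>x. y t + c *\<^sub>R x) -` A t))"
  proof (rule lborel_product.emeasure_PiM)
    fix t assume "t \<in> {..<L}"
    then have [measurable]: "A t \<in> sets borel" using A by simp
    have "(\<lambda>x. y t + c *\<^sub>R x) -` A t \<inter> space borel \<in> sets borel" by measurable
    then show "(\<lambda>x. y t + c *\<^sub>R x) -` A t \<in> sets lborel" by simp
  qed simp
  also have "ennreal (\<bar>c\<bar> ^ (L * DIM('a))) * (\<Prod>t<L. emeasure lborel ((\<lambda>x. y t + c *\<^sub>R x) -` A t))
     = (\<Prod>t<L. emeasure lborel (A t))"
  proof -
    have "ennreal (\<bar>c\<bar> ^ (L * DIM('a))) = (\<Prod>t<L. ennreal (\<bar>c\<bar> ^ DIM('a)))"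
      by (simp add: ennreal_power power_mult[symmetric] mult.commute)
    then show ?thesis by (simp only: prod.distrib[symmetric]) (intro prod.cong, auto simp: one)
  qed
  finally show "emeasure (density (distr ?M ?M ?T) (\<lambda>_. ennreal (\<bar>c\<bar> ^ (L * DIM('a))))) (Pi\<^sub>E {..<L} A)
     = (\<Prod>t<L. emeasure lborel (A t))" .
qed simp_all

lemma nn_integral_lebesgue_vec_affine:
  fixes y :: "nat \<Rightarrow> 'a::euclidean_space"
  assumes c: "c \<noteq> 0" and f[measurable]: "f \<in> borel_measurable (lebesgue_vec L)"
  shows "(\<integral>\<^sup>+x. f x \<partial>lebesgue_vec L) = ennreal (\<bar>c\<bar> ^ (L * DIM('a))) *
    (\<integral>\<^sup>+x. f (\<lambda>t\<in>{..<L}. y t + c *\<^sub>R x t) \<partial>lebesgue_vec L)"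
proof -
  let ?T = "\<lambda>x. \<lambda>t\<in>{..<L}. y t + c *\<^sub>R x t"
  have T[measurable]: "?T \<in> lebesgue_vec L \<rightarrow>\<^sub>M lebesgue_vec L" by measurable
  show ?thesis
    by (subst lebesgue_vec_affine[OF c, of L y, symmetric])
      (simp add: nn_integral_density nn_integral_cmult nn_integral_distr)
qed

lemma nn_integral_lebesgue_vec_scale:
  fixes f :: "(nat \<Rightarrow> 'a::euclidean_space) \<Rightarrow> ennreal"
  assumes "c \<noteq> 0" "f \<in> borel_measurable (lebesgue_vec L)"
  shows "(\<integral>\<^sup>+x. f x \<partial>lebesgue_vec L) = ennreal (\<bar>c\<bar> ^ (L * DIM('a))) *
    (\<integral>\<^sup>+x. f (vscale L c x) \<partial>lebesgue_vec L)"
  using nn_integral_lebesgue_vec_affine[OF assms, of "\<lambda>_. 0"] by simp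

lemma measurable_vnorm2[measurable]:
  "vnorm2 {..<L} \<in> borel_measurable (lebesgue_vec L :: (nat \<Rightarrow> 'a::euclidean_space) measure)"
  "vnorm2 {..<L} \<in> borel_measurable (PiM {..<L} (\<lambda>_. borel :: 'a::euclidean_space measure))"
  unfolding vnorm2_def[abs_def] by measurable

lemma measurable_vinner[measurable]:
  "(\<lambda>x. vinner L x h) \<in> borel_measurable (lebesgue_vec L :: (nat \<Rightarrow> 'a::euclidean_space) measure)"
  "(\<lambda>x. vinner L x h) \<in> borel_measurable (PiM {..<L} (\<lambda>_. borel :: 'a::euclidean_space measure))"
  unfolding vinner_def[abs_def] by measurable

lemma measurable_direction_borel [measurable]:
  "direction L \<in> PiM {..<L} (\<lambda>_. borel) \<rightarrow>\<^sub>M PiM {..<L} (\<lambda>_. borel :: 'a::euclidean_space measure)"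
  unfolding direction_def[abs_def] by measurable

lemma sets_lebesgue_vec: "sets (lebesgue_vec L) = sets (PiM {..<L} (\<lambda>_. borel :: 'a::euclidean_space measure))"
  by (intro sets_PiM_cong) auto

lemma measurable_direction[measurable]:
  "direction L \<in> lebesgue_vec L \<rightarrow>\<^sub>M PiM {..<L} (\<lambda>_. borel :: 'a::euclidean_space measure)"
  "direction L \<in> lebesgue_vec L \<rightarrow>\<^sub>M (lebesgue_vec L :: (nat \<Rightarrow> 'a::euclidean_space) measure)"
  using measurable_direction_borel by (simp_all add: sets_lebesgue_vec cong: measurable_cong_sets)

section \<open>The Gaussian weight and its integrals\<close>

definition gauss_weight :: "nat \<Rightarrow> (nat \<Rightarrow> 'a::euclidean_space) \<Rightarrow> real" where
  "gauss_weight L x = exp (- (vnorm2 {..<L} x)\<^sup>2 / 2)"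

lemma measurable_gauss_weight[measurable]:
  "gauss_weight L \<in> borel_measurable (lebesgue_vec L :: (nat \<Rightarrow> 'a::euclidean_space) measure)"
  unfolding gauss_weight_def[abs_def] by measurable

lemma gauss_weight_nonneg [simp]: "0 \<le> gauss_weight L x"
  by (simp add: gauss_weight_def)

lemma nn_integral_gauss_real: "(\<integral>\<^sup>+x. ennreal (exp (- x\<^sup>2 / 2)) \<partial>lborel) = ennreal (sqrt (2 * pi))"
proof -
  interpret prob_space "density lborel (normal_density 0 1)"
    by (rule prob_space_normal_density) simp
  have "(\<integral>\<^sup>+x. ennreal (exp (- x\<^sup>2 / 2)) \<partial>lborel)
     = (\<integral>\<^sup>+x. ennreal (sqrt (2 * pi)) * ennreal (normal_density 0 1 x) \<partial>lborel)"
    by (intro nn_integral_cong) (simp add: normal_density_def ennreal_mult[symmetric])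
  also have "\<dots> = ennreal (sqrt (2 * pi)) * (\<integral>\<^sup>+x. ennreal (normal_density 0 1 x) \<partial>lborel)"
    by (rule nn_integral_cmult) simp
  also have "(\<integral>\<^sup>+x. ennreal (normal_density 0 1 x) \<partial>lborel) = 1"
    using emeasure_space_1 by (simp add: emeasure_density)
  finally show ?thesis by simp
qed

lemma nn_integral_gauss:
  "(\<integral>\<^sup>+x. ennreal (exp (- (norm (x::'a::euclidean_space))\<^sup>2 / 2)) \<partial>lborel) = ennreal (sqrt (2 * pi) ^ DIM('a))"
proof -
  have "(\<integral>\<^sup>+x. ennreal (exp (- (norm (x::'a))\<^sup>2 / 2)) \<partial>lborel)
     = (\<integral>\<^sup>+(x::'a). (\<Prod>b\<in>Basis. ennreal (exp (- (x \<bullet> b)\<^sup>2 / 2))) \<partial>lborel)"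
  proof (intro nn_integral_cong)
    fix x :: 'a
    have "- (norm x)\<^sup>2 / 2 = (\<Sum>b\<in>Basis. - (x \<bullet> b)\<^sup>2 / 2)"
      unfolding power2_norm_eq_inner euclidean_inner[of x x]
      by (simp add: power2_eq_square sum_divide_distrib[symmetric] sum_negf)
    then show "ennreal (exp (- (norm x)\<^sup>2 / 2)) = (\<Prod>b\<in>Basis. ennreal (exp (- (x \<bullet> b)\<^sup>2 / 2)))"
      by (simp add: exp_sum prod_ennreal)
  qed
  also have "\<dots> = (\<Prod>b\<in>(Basis::'a set). (\<integral>\<^sup>+x. ennreal (exp (- x\<^sup>2 / 2)) \<partial>lborel))"
    by (rule nn_integral_lborel_prod) auto
  finally show ?thesis unfolding nn_integral_gauss_real by (simp add: ennreal_power)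
qed

text \<open>The total integral of \<open>gauss_weight\<close>; the type argument supplies the
  dimension.\<close>

definition gauss_mass :: "'a::euclidean_space itself \<Rightarrow> nat \<Rightarrow> real" where
  "gauss_mass _ L = sqrt (2 * pi) ^ (L * DIM('a))"

lemma gauss_mass_pos [simp]: "0 < gauss_mass TYPE('a::euclidean_space) L"
  by (simp add: gauss_mass_def)

lemma gauss_mass_neq_0 [simp]: "gauss_mass TYPE('a::euclidean_space) L \<noteq> 0"
  and gauss_mass_nonneg [simp]: "0 \<le> gauss_mass TYPE('a) L"
  by (simp_all add: gauss_mass_def)

lemma gauss_weight_prod:
  "gauss_weight L x = (\<Prod>t<L. exp (- (norm (x t))\<^sup>2 / 2))"
proof -
  have "- (vnorm2 {..<L} x)\<^sup>2 / 2 = (\<Sum>t<L. - (norm (x t))\<^sup>2 / 2)"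
    unfolding vnorm2_square by (simp add: sum_divide_distrib[symmetric] sum_negf)
  then show ?thesis by (simp add: gauss_weight_def exp_sum)
qed

lemma nn_integral_gauss_weight:
  "(\<integral>\<^sup>+(x::nat \<Rightarrow> 'a::euclidean_space). ennreal (gauss_weight L x) \<partial>lebesgue_vec L) = ennreal (gauss_mass TYPE('a) L)"
proof -
  let ?M = "lebesgue_vec L :: (nat \<Rightarrow> 'a) measure"
  have "(\<integral>\<^sup>+x. ennreal (gauss_weight L x) \<partial>?M) = (\<integral>\<^sup>+x. (\<Prod>t<L. ennreal (exp (- (norm (x t))\<^sup>2 / 2))) \<partial>?M)"
    by (simp add: gauss_weight_prod prod_ennreal)
  also have "\<dots> = (\<Prod>t<L. (\<integral>\<^sup>+(x::'a). ennreal (exp (- (norm x)\<^sup>2 / 2)) \<partial>lborel))"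
    by (rule lborel_product.product_nn_integral_prod) auto
  also have "\<dots> = ennreal (gauss_mass TYPE('a) L)"
    unfolding nn_integral_gauss by (simp add: ennreal_power gauss_mass_def power_mult[symmetric] mult.commute)
  finally show ?thesis .
qed

lemma gauss_weight_vscale: "gauss_weight L (vscale L c x) = exp (- c\<^sup>2 * (vnorm2 {..<L} x)\<^sup>2 / 2)"
  by (simp add: gauss_weight_def vnorm2_vscale power_mult_distrib)

text \<open>Completing the square: after translation by \<open>h\<close> the exponential factor is
  constant. Up to the mass this is the Gaussian moment generating function.\<close>

lemma nn_integral_exp_vinner_gauss:
  fixes h :: "nat \<Rightarrow> 'a::euclidean_space"
  shows "(\<integral>\<^sup>+x. ennreal (exp (vinner L x h) * gauss_weight L x) \<partial>lebesgue_vec L)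
    = ennreal (exp ((vnorm2 {..<L} h)\<^sup>2 / 2) * gauss_mass TYPE('a) L)"
proof -
  let ?T = "\<lambda>x. \<lambda>t\<in>{..<L}. h t + 1 *\<^sub>R x t"
  have "exp (vinner L (?T x) h) * gauss_weight L (?T x) = exp ((vnorm2 {..<L} h)\<^sup>2 / 2) * gauss_weight L x" for x
  proof -
    have "(vnorm2 {..<L} (?T x))\<^sup>2 = (vnorm2 {..<L} h)\<^sup>2 + 2 * vinner L x h + (vnorm2 {..<L} x)\<^sup>2"
      by (simp add: vnorm2_square_inner vinner_def inner_add_left inner_add_right sum.distrib sum_distrib_left inner_commute[of "h _" "x _"])
    moreover have "vinner L (?T x) h = (vnorm2 {..<L} h)\<^sup>2 + vinner L x h"
      by (simp add: vnorm2_square_inner vinner_def inner_add_left sum.distrib)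
    ultimately show ?thesis
      unfolding gauss_weight_def by (simp add: exp_add[symmetric] field_simps)
  qed
  then show ?thesis
    by (subst nn_integral_lebesgue_vec_affine[where c = 1 and y = h])
      (simp_all add: ennreal_mult nn_integral_cmult nn_integral_gauss_weight)
qed

text \<open>Since \<open>f\<close> is invariant under the scaling, \<open>c\<close> enters only
  through the Jacobian and the exponent. Varying \<open>c\<close> therefore gives information on
  moments of the radius.\<close>

lemma nn_integral_gauss_scaled:
  fixes f :: "(nat \<Rightarrow> 'a::euclidean_space) \<Rightarrow> real"
  assumes c: "c > 0" and f[measurable]: "f \<in> borel_measurable (lebesgue_vec L)"
    and hom: "\<And>x. f (vscale L c x) = f x"
  shows "(\<integral>\<^sup>+x. ennreal (f x * gauss_weight L x) \<partial>lebesgue_vec L) = ennreal (c ^ (L * DIM('a))) *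
    (\<integral>\<^sup>+x. ennreal (f x * exp (- c\<^sup>2 * (vnorm2 {..<L} x)\<^sup>2 / 2)) \<partial>lebesgue_vec L)"
  using c nn_integral_lebesgue_vec_scale[of c "\<lambda>x. ennreal (f x * gauss_weight L x)" L]
  by (simp add: hom gauss_weight_vscale)

section \<open>Sub-Gaussian directions\<close>

text \<open>Equality holds, by differentiating the scaling identity \<open>nn_integral_gauss_scaled\<close> at
  \<open>c = 1\<close>; the difference quotient from the right gives the inequality without any integrability of
  \<open>f \<cdot> |x|\<^sup>2\<close>.\<close>

lemma homogeneous_second_moment_ge:
  fixes f :: "(nat \<Rightarrow> 'a::euclidean_space) \<Rightarrow> real"
  assumes f[measurable]: "f \<in> borel_measurable (lebesgue_vec L)"
    and hom: "\<And>c x. c > 0 \<Longrightarrow> f (vscale L c x) = f x"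
    and f0: "\<And>x. 0 \<le> f x"
    and fin: "(\<integral>\<^sup>+x. ennreal (f x * gauss_weight L x) \<partial>lebesgue_vec L) < \<infinity>"
  shows "ennreal (L * DIM('a)) * (\<integral>\<^sup>+x. ennreal (f x * gauss_weight L x) \<partial>lebesgue_vec L)
    \<le> (\<integral>\<^sup>+x. ennreal (f x * (vnorm2 {..<L} x)\<^sup>2 * gauss_weight L x) \<partial>lebesgue_vec L)"
    (is "_ * ?F \<le> ?Q")
proof (cases "?Q = \<infinity>")
  case False
  define D where "D = L * DIM('a)"
  obtain F where F: "?F = ennreal F" "0 \<le> F" using fin by (cases ?F) auto
  obtain Q where Q: "?Q = ennreal Q" "0 \<le> Q" using False by (cases ?Q) auto
  have main: "real D * F \<le> (1 + e / 2) * (1 + real D * e) * Q" if e: "e > 0" for e :: real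
  proof -
    define c where "c = 1 + e"
    have c: "c > 0" using e by (simp add: c_def)
    let ?G = "\<integral>\<^sup>+x. ennreal (f x * exp (- c\<^sup>2 * (vnorm2 {..<L} x)\<^sup>2 / 2)) \<partial>lebesgue_vec L"
    have FG: "?F = ennreal (c ^ D) * ?G"
      unfolding D_def by (rule nn_integral_gauss_scaled[OF c f hom[OF c]])
    have cD: "c ^ D > 0" using c by simp
    have "?G \<noteq> \<infinity>"
    proof
      assume "?G = \<infinity>"
      then have "?F = \<infinity>" using FG c by (simp add: ennreal_mult_top)
      then show False using fin by simp
    qed
    then obtain G where G: "?G = ennreal G" "0 \<le> G" by (cases ?G) auto
    have FG': "F = c ^ D * G" using FG F G cD by (simp add: ennreal_mult[symmetric])
    \<comment> \<open>From \<open>1 - u \<le> exp (- u)\<close> at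
      \<open>u = (c^2 - 1) / 2 * |x|^2\<close>, multiplied by the weight.\<close>
    have "?F \<le> (\<integral>\<^sup>+x. ennreal (f x * exp (- c\<^sup>2 * (vnorm2 {..<L} x)\<^sup>2 / 2)) +
        ennreal ((c\<^sup>2 - 1) / 2) * ennreal (f x * (vnorm2 {..<L} x)\<^sup>2 * gauss_weight L x) \<partial>lebesgue_vec L)"
    proof (rule nn_integral_mono)
      fix x :: "nat \<Rightarrow> 'a"
      let ?r = "(vnorm2 {..<L} x)\<^sup>2"
      have c1: "0 \<le> (c\<^sup>2 - 1) / 2" using e by (simp add: c_def power2_eq_square algebra_simps)
      have "gauss_weight L x * (1 + - ((c\<^sup>2 - 1) / 2 * ?r)) \<le> gauss_weight L x * exp (- ((c\<^sup>2 - 1) / 2 * ?r))"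
        by (intro mult_left_mono exp_ge_add_one_self gauss_weight_nonneg)
      also have "gauss_weight L x * exp (- ((c\<^sup>2 - 1) / 2 * ?r)) = exp (- c\<^sup>2 * ?r / 2)"
        unfolding gauss_weight_def exp_add[symmetric] by (rule arg_cong[of _ _ exp]) (simp add: field_simps)
      finally have "gauss_weight L x \<le> exp (- c\<^sup>2 * ?r / 2) + (c\<^sup>2 - 1) / 2 * (?r * gauss_weight L x)"
        by (simp add: algebra_simps)
      from mult_left_mono[OF this f0[of x]]
      have "f x * gauss_weight L x \<le> f x * exp (- c\<^sup>2 * ?r / 2) + (c\<^sup>2 - 1) / 2 * (f x * ?r * gauss_weight L x)"
        by (simp add: algebra_simps)
      then have "ennreal (f x * gauss_weight L x) \<le> ennreal (f x * exp (- c\<^sup>2 * ?r / 2) + (c\<^sup>2 - 1) / 2 * (f x * ?r * gauss_weight L x))"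
        by (rule ennreal_leI)
      also have "\<dots> = ennreal (f x * exp (- c\<^sup>2 * ?r / 2)) + ennreal ((c\<^sup>2 - 1) / 2) * ennreal (f x * ?r * gauss_weight L x)"
        using c1 f0[of x] by (subst ennreal_plus) (auto simp: ennreal_mult'[symmetric])
      finally show "ennreal (f x * gauss_weight L x) \<le> \<dots>" .
    qed
    also have "\<dots> = ?G + ennreal ((c\<^sup>2 - 1) / 2) * ?Q"
      by (simp add: nn_integral_add nn_integral_cmult)
    finally have "ennreal F \<le> ennreal G + ennreal ((c\<^sup>2 - 1) / 2) * ennreal Q" by (simp only: F G Q)
    moreover have "0 \<le> (c\<^sup>2 - 1) / 2" using e by (simp add: c_def power2_eq_square algebra_simps)
    ultimately have le: "F \<le> G + (c\<^sup>2 - 1) / 2 * Q"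
      using F G Q by (simp add: ennreal_mult[symmetric] ennreal_plus[symmetric] del: ennreal_plus)
    \<comment> \<open>The linear part of the Jacobian suffices, and it makes the bound on the
      difference quotient a polynomial in \<open>e\<close>.\<close>
    have bern: "1 + real D * e \<le> c ^ D"
      using Bernoulli_inequality[of e D] e by (simp add: c_def)
    have pos: "1 + real D * e > 0" using e by (intro add_pos_nonneg) auto
    have "(1 + real D * e) * G \<le> F" unfolding FG' by (rule mult_right_mono[OF bern G(2)])
    moreover have "(1 + real D * e) * F \<le> (1 + real D * e) * G + (1 + real D * e) * ((c\<^sup>2 - 1) / 2 * Q)"
      unfolding distrib_left[symmetric] using le pos by (intro mult_left_mono) auto
    moreover have "(1 + real D * e) * F = F + real D * e * F" by (simp add: distrib_right)
    ultimately have "real D * e * F \<le> (1 + real D * e) * ((c\<^sup>2 - 1) / 2 * Q)" by linarith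
    also have "\<dots> = e * ((1 + e / 2) * (1 + real D * e) * Q)"
      by (simp add: c_def power2_eq_square field_simps)
    finally have "e * (real D * F) \<le> e * ((1 + e / 2) * (1 + real D * e) * Q)" by (simp add: mult_ac)
    then show ?thesis using e by (simp only: mult_le_cancel_left_pos)
  qed
  have "((\<lambda>e. (1 + e / 2) * (1 + real D * e) * Q) \<longlongrightarrow> (1 + 0 / 2) * (1 + real D * 0) * Q) (at_right 0)"
    by (intro tendsto_intros) auto
  then have "real D * F \<le> (1 + 0 / 2) * (1 + real D * 0) * Q"
    by (rule tendsto_lowerbound) (auto intro!: eventually_at_right_less[THEN eventually_mono] main)
  then have "ennreal (real D) * ennreal F \<le> ennreal Q"
    using F by (simp add: ennreal_mult[symmetric] ennreal_leI)
  then show ?thesis using F Q by (simp add: D_def)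
qed simp

lemma borel_measurable_sinh_cosh [measurable]:
  "(sinh :: real \<Rightarrow> real) \<in> borel_measurable borel" "(cosh :: real \<Rightarrow> real) \<in> borel_measurable borel"
  by (auto intro!: borel_measurable_continuous_onI continuous_intros)

text \<open>The weight is even, so \<open>g\<close> and \<open>- g\<close> give the same integral
  and averaging the two gives \<open>cosh\<close>, to which the tangent bound applies.\<close>

lemma nn_integral_exp_odd_eq_cosh:
  fixes g :: "(nat \<Rightarrow> 'a::euclidean_space) \<Rightarrow> real"
  assumes g[measurable]: "g \<in> borel_measurable (lebesgue_vec L)"
    and odd: "\<And>x. g (vscale L (-1) x) = - g x"
  shows "(\<integral>\<^sup>+x. ennreal (exp (g x) * gauss_weight L x) \<partial>lebesgue_vec L)
    = (\<integral>\<^sup>+x. ennreal (cosh (g x) * gauss_weight L x) \<partial>lebesgue_vec L)" (is "?E = ?C")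
proof -
  have "?E = (\<integral>\<^sup>+x. ennreal (exp (- g x) * gauss_weight L x) \<partial>lebesgue_vec L)"
  proof -
    have w: "gauss_weight L (vscale L (-1) x) = gauss_weight L x" for x :: "nat \<Rightarrow> 'a"
      by (simp only: gauss_weight_vscale) (simp add: gauss_weight_def)
    show ?thesis
      using nn_integral_lebesgue_vec_scale[of "-1" "\<lambda>x. ennreal (exp (g x) * gauss_weight L x)" L]
      by (simp only: odd w) simp
  qed
  then have "?E + ?E = ?E + (\<integral>\<^sup>+x. ennreal (exp (- g x) * gauss_weight L x) \<partial>lebesgue_vec L)" by simp
  also have "\<dots> = (\<integral>\<^sup>+x. ennreal (exp (g x) * gauss_weight L x) + ennreal (exp (- g x) * gauss_weight L x) \<partial>lebesgue_vec L)"
    by (subst nn_integral_add) auto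
  also have "\<dots> = (\<integral>\<^sup>+x. ennreal 2 * ennreal (cosh (g x) * gauss_weight L x) \<partial>lebesgue_vec L)"
    by (intro nn_integral_cong)
      (simp add: ennreal_plus[symmetric] ennreal_mult'[symmetric] cosh_def field_simps del: ennreal_plus ennreal_numeral)
  also have "\<dots> = 2 * ?C" by (subst nn_integral_cmult) auto
  finally have "2 * ?E = 2 * ?C" by (simp only: mult_2[symmetric])
  then show ?thesis by (simp add: ennreal_mult_cancel_left)
qed

text \<open>The projection \<open>q\<close> of a uniform direction is sub-Gaussian with the variance proxy \<open>1/D\<close> of the
  Gaussian \<open>q |x| / \<surd>D\<close>: by convexity of \<open>u \<mapsto> cosh (q \<surd>u)\<close>, replacing \<open>|x|\<^sup>2\<close> by its mean \<open>D\<close>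
  decreases the expectation of \<open>cosh\<close>.\<close>

lemma direction_subgaussian:
  fixes h :: "nat \<Rightarrow> 'a::euclidean_space"
  assumes L: "0 < L"
  shows "(\<integral>\<^sup>+x. ennreal (exp (vinner L (direction L x) h) * gauss_weight L x) \<partial>lebesgue_vec L)
    \<le> ennreal (exp ((vnorm2 {..<L} h)\<^sup>2 / (2 * real (L * DIM('a)))) * gauss_mass TYPE('a) L)"
proof -
  define D where "D = real (L * DIM('a))"
  have D: "D > 0" using L by (simp add: D_def)
  let ?q = "\<lambda>x::nat \<Rightarrow> 'a. vinner L (direction L x) h"
  \<comment> \<open>Slope of the tangent to \<open>u \<mapsto> cosh (?q x * sqrt u)\<close> at
    \<open>u = 1\<close>. It is nonnegative and depends only on the direction of \<open>x\<close>,
    as the second-moment inequality demands.\<close>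
  let ?K = "\<lambda>x. ?q x * sinh (?q x) / 2"
  let ?w = "gauss_weight L"
  \<comment> \<open>The factor \<open>1 / sqrt D\<close> gives \<open>|x|^2 / D\<close> the mean 1,
    which is the point of tangency.\<close>
  let ?h = "\<lambda>t. (1 / sqrt D) *\<^sub>R h t"
  have q[measurable]: "?q \<in> borel_measurable (lebesgue_vec L)"
    by (rule measurable_compose[OF measurable_direction(2) measurable_vinner(1)])
  have K0: "0 \<le> ?K x" for x by (cases "0 \<le> ?q x") (auto simp: mult_nonneg_nonneg mult_nonpos_nonpos)
  have Kle: "?K x \<le> vnorm2 {..<L} h * sinh (vnorm2 {..<L} h) / 2" for x
  proof -
    have "vnorm2 {..<L} (direction L x) * vnorm2 {..<L} h \<le> 1 * vnorm2 {..<L} h"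
      by (intro mult_right_mono vnorm2_direction_le) simp
    then have "\<bar>?q x\<bar> \<le> vnorm2 {..<L} h" using vinner_le[of L "direction L x" h] by linarith
    moreover from this have "sinh \<bar>?q x\<bar> \<le> sinh (vnorm2 {..<L} h)" by (simp only: sinh_real_le_iff)
    ultimately have "\<bar>?q x\<bar> * sinh \<bar>?q x\<bar> \<le> vnorm2 {..<L} h * sinh (vnorm2 {..<L} h)"
      by (rule mult_mono) auto
    moreover have "?q x * sinh (?q x) = \<bar>?q x\<bar> * sinh \<bar>?q x\<bar>" by (simp add: abs_if)
    ultimately show ?thesis by simp
  qed
  let ?IK = "\<integral>\<^sup>+x. ennreal (?K x * ?w x) \<partial>lebesgue_vec L"
  \<comment> \<open>Directions have length at most 1, so \<open>?K\<close> is bounded. Finiteness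
    enters the second-moment inequality and again the final cancellation.\<close>
  have fin: "?IK < \<infinity>"
  proof -
    have "?IK \<le> (\<integral>\<^sup>+(x::nat \<Rightarrow> 'a). ennreal (vnorm2 {..<L} h * sinh (vnorm2 {..<L} h) / 2) * ennreal (?w x) \<partial>lebesgue_vec L)"
      using Kle by (intro nn_integral_mono) (simp add: ennreal_mult'[symmetric] ennreal_leI mult_right_mono del: times_divide_eq_left)
    also have "\<dots> < \<infinity>"
      by (subst nn_integral_cmult) (auto simp: nn_integral_gauss_weight ennreal_mult_less_top)
    finally show ?thesis .
  qed
  have mom: "ennreal D * ?IK \<le> (\<integral>\<^sup>+x. ennreal (?K x * (vnorm2 {..<L} x)\<^sup>2 * ?w x) \<partial>lebesgue_vec L)"
    unfolding D_def by (rule homogeneous_second_moment_ge) (use K0 fin in \<open>simp_all add: direction_vscale\<close>)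
  let ?IQ = "\<integral>\<^sup>+x. ennreal (?K x * ((vnorm2 {..<L} x)\<^sup>2 / D) * ?w x) \<partial>lebesgue_vec L"
  have "ennreal D * ?IQ = (\<integral>\<^sup>+x. ennreal (?K x * (vnorm2 {..<L} x)\<^sup>2 * ?w x) \<partial>lebesgue_vec L)"
    using D by (subst nn_integral_cmult[symmetric]) (auto intro!: nn_integral_cong simp: ennreal_mult'[symmetric] mult_ac)
  with mom have "ennreal D * ?IK \<le> ennreal D * ?IQ" by simp
  then have IKQ: "?IK \<le> ?IQ" using D by (simp add: ennreal_mult_le_mult_iff)
  let ?C = "\<integral>\<^sup>+x. ennreal (cosh (?q x) * ?w x) \<partial>lebesgue_vec L"
  let ?E = "\<integral>\<^sup>+x. ennreal (cosh (vinner L x ?h) * ?w x) \<partial>lebesgue_vec L"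
  \<comment> \<open>The integrated tangent inequality is arranged without subtraction: its negative
    term stands on the other side, and the finite \<open>?IK\<close> cancels at the end.\<close>
  have "?IK + ?C \<le> ?IQ + ?C" using IKQ by (rule add_right_mono)
  also have "\<dots> = (\<integral>\<^sup>+x. ennreal (?K x * ((vnorm2 {..<L} x)\<^sup>2 / D) * ?w x) + ennreal (cosh (?q x) * ?w x) \<partial>lebesgue_vec L)"
    by (subst nn_integral_add) auto
  also have "\<dots> \<le> (\<integral>\<^sup>+x. ennreal (?K x * ?w x) + ennreal (cosh (vinner L x ?h) * ?w x) \<partial>lebesgue_vec L)"
  proof (rule nn_integral_mono)
    fix x :: "nat \<Rightarrow> 'a"
    let ?r = "vnorm2 {..<L} x"
    have v: "vinner L x ?h = ?q x * (?r / sqrt D)"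
      using vinner_direction[of L x h] by (simp add: vinner_def sum_divide_distrib[symmetric])
    have "cosh (?q x) + ?K x * ((?r / sqrt D)\<^sup>2 - 1) \<le> cosh (?q x * (?r / sqrt D))"
      by (rule cosh_tangent) (use D in simp)
    then have "?K x * (?r\<^sup>2 / D) + cosh (?q x) \<le> ?K x + cosh (vinner L x ?h)"
      unfolding v using D by (simp add: power_divide right_diff_distrib)
    from mult_right_mono[OF this gauss_weight_nonneg[of L x]]
    have "?K x * (?r\<^sup>2 / D) * ?w x + cosh (?q x) * ?w x \<le> ?K x * ?w x + cosh (vinner L x ?h) * ?w x"
      by (simp only: distrib_right)
    then have "ennreal (?K x * (?r\<^sup>2 / D) * ?w x + cosh (?q x) * ?w x) \<le> ennreal (?K x * ?w x + cosh (vinner L x ?h) * ?w x)"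
      by (rule ennreal_leI)
    moreover have "0 \<le> ?K x * (?r\<^sup>2 / D) * ?w x" "0 \<le> ?K x * ?w x"
      using K0[of x] D by (auto simp del: times_divide_eq_left intro!: mult_nonneg_nonneg)
    ultimately show "ennreal (?K x * (?r\<^sup>2 / D) * ?w x) + ennreal (cosh (?q x) * ?w x)
        \<le> ennreal (?K x * ?w x) + ennreal (cosh (vinner L x ?h) * ?w x)"
      by (subst (asm) ennreal_plus; (subst (asm) ennreal_plus)?) simp_all
  qed
  also have "\<dots> = ?IK + ?E" by (subst nn_integral_add) auto
  finally have "?C \<le> ?E"
    using less_imp_neq[OF fin] by (simp only: ennreal_add_left_cancel_le infinity_ennreal_def simp_thms)
  also have "?E = (\<integral>\<^sup>+x. ennreal (exp (vinner L x ?h) * ?w x) \<partial>lebesgue_vec L)"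
    by (rule nn_integral_exp_odd_eq_cosh[symmetric]) (simp_all only: vinner_uminus measurable_vinner)
  also have "\<dots> = ennreal (exp ((vnorm2 {..<L} ?h)\<^sup>2 / 2) * gauss_mass TYPE('a) L)"
    by (rule nn_integral_exp_vinner_gauss)
  also have "(vnorm2 {..<L} ?h)\<^sup>2 / 2 = (vnorm2 {..<L} h)\<^sup>2 / (2 * real (L * DIM('a)))"
    unfolding vnorm2_scale using D by (simp add: power_mult_distrib power_divide D_def)
  finally show ?thesis
    by (subst nn_integral_exp_odd_eq_cosh) (simp_all only: direction_uminus vinner_uminus q)
qed

section \<open>The row models\<close>

lemma sigma_finite_lebesgue_vec: "sigma_finite_measure (lebesgue_vec L :: (nat \<Rightarrow> 'a::euclidean_space) measure)"
  by (rule lborel_product.sigma_finite) simp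

text \<open>The integrand is the derivative of \<open>- exp (- r^2 / 2)\<close>. It serves as the
  density over radii that mixes indicators of balls into the Gaussian weight.\<close>

lemma nn_integral_exp_tail:
  fixes a :: real
  assumes "0 \<le> a"
  shows "(\<integral>\<^sup>+r. ennreal (r * exp (- r\<^sup>2 / 2)) * indicator {a..} r \<partial>lborel) = ennreal (exp (- a\<^sup>2 / 2))"
proof -
  have "((\<lambda>r::real. - exp (- r\<^sup>2 / 2)) \<longlongrightarrow> - 0) at_top"
  proof (rule tendsto_minus)
    have "filterlim (\<lambda>r::real. r\<^sup>2 / 2) at_top at_top"
      using filterlim_tendsto_pos_mult_at_top[OF tendsto_const, of "1/2 :: real" "\<lambda>r::real. r\<^sup>2" at_top]
        filterlim_pow_at_top[OF _ filterlim_ident, of 2] by simp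
    then have "filterlim (\<lambda>r::real. - (r\<^sup>2 / 2)) at_bot at_top"
      by (simp add: filterlim_uminus_at_top)
    then show "((\<lambda>r::real. exp (- r\<^sup>2 / 2)) \<longlongrightarrow> 0) at_top"
      using filterlim_compose[OF exp_at_bot] by fastforce
  qed
  then have "(\<integral>\<^sup>+r. ennreal (r * exp (- r\<^sup>2 / 2)) * indicator {a..} r \<partial>lborel) = - 0 - (- exp (- a\<^sup>2 / 2))"
    by (intro nn_integral_FTC_atLeast) (use assms in \<open>auto intro!: derivative_eq_intros\<close>)
  then show ?thesis by simp
qed

text \<open>Layer-cake: the Gaussian weight is a mixture of indicators of balls, and all balls see the
  same average of a function of the direction.\<close>

lemma nn_integral_homogeneous_gauss:
  fixes f :: "(nat \<Rightarrow> 'a::euclidean_space) \<Rightarrow> ennreal"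
  assumes f[measurable]: "f \<in> borel_measurable (lebesgue_vec L)"
    and hom: "\<And>c x. c > 0 \<Longrightarrow> f (vscale L c x) = f x"
  shows "(\<integral>\<^sup>+x. f x * ennreal (gauss_weight L x) \<partial>lebesgue_vec L) =
    (\<integral>\<^sup>+r. ennreal (r * exp (- r\<^sup>2 / 2) * \<bar>r\<bar> ^ (L * DIM('a))) * indicator {0<..} r \<partial>lborel) *
    (\<integral>\<^sup>+x. f x * indicator {x. vnorm2 {..<L} x \<le> 1} x \<partial>lebesgue_vec L)"
proof -
  let ?M = "lebesgue_vec L :: (nat \<Rightarrow> 'a) measure"
  let ?g = "\<lambda>r::real. ennreal (r * exp (- r\<^sup>2 / 2))"
  let ?I = "\<lambda>r x. indicator {x. vnorm2 {..<L} x \<le> r} x :: ennreal"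
  interpret M: sigma_finite_measure ?M by (rule sigma_finite_lebesgue_vec)
  interpret P: pair_sigma_finite ?M "lborel :: real measure" by standard
  have [measurable]: "(\<lambda>(x, r). ?I r x) \<in> borel_measurable (?M \<Otimes>\<^sub>M lborel)" 
    unfolding indicator_def mem_Collect_eq by measurable
  have [measurable]: "?I r \<in> borel_measurable ?M" for r
    unfolding indicator_def mem_Collect_eq by measurable
  \<comment> \<open>The ball of radius \<open>r\<close> is a scaled unit ball and \<open>f\<close>
    does not see the scaling, so only the Jacobian remains.\<close>
  have ball: "(\<integral>\<^sup>+x. f x * ?I r x \<partial>?M) = ennreal (\<bar>r\<bar> ^ (L * DIM('a))) * (\<integral>\<^sup>+x. f x * ?I 1 x \<partial>?M)" if r: "r > 0" for r
  proof -
    have "?I r (vscale L r x) = ?I 1 x" for x :: "nat \<Rightarrow> 'a"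
      using r by (simp add: indicator_def vnorm2_vscale mult_le_cancel_left2)
    then show ?thesis
      using r by (subst nn_integral_lebesgue_vec_scale[of r]) (simp_all add: hom)
  qed
  have "(\<integral>\<^sup>+x. f x * ennreal (gauss_weight L x) \<partial>?M) = (\<integral>\<^sup>+x. \<integral>\<^sup>+r. f x * (?g r * ?I r x) \<partial>lborel \<partial>?M)"
  proof (intro nn_integral_cong)
    fix x :: "nat \<Rightarrow> 'a"
    have "ennreal (gauss_weight L x) = (\<integral>\<^sup>+r. ?g r * indicator {vnorm2 {..<L} x..} r \<partial>lborel)"
      unfolding gauss_weight_def by (rule nn_integral_exp_tail[symmetric]) simp
    also have "\<dots> = (\<integral>\<^sup>+r. ?g r * ?I r x \<partial>lborel)"
      by (intro nn_integral_cong) (simp add: indicator_def)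
    finally show "f x * ennreal (gauss_weight L x) = (\<integral>\<^sup>+r. f x * (?g r * ?I r x) \<partial>lborel)"
      by (subst nn_integral_cmult) (simp_all add: indicator_def)
  qed
  also have "\<dots> = (\<integral>\<^sup>+r. \<integral>\<^sup>+x. f x * (?g r * ?I r x) \<partial>?M \<partial>lborel)"
    by (rule P.Fubini'[symmetric]) measurable
  also have "\<dots> = (\<integral>\<^sup>+r. (ennreal (r * exp (- r\<^sup>2 / 2) * \<bar>r\<bar> ^ (L * DIM('a))) * indicator {0<..} r) * (\<integral>\<^sup>+x. f x * ?I 1 x \<partial>?M) \<partial>lborel)"
  proof (intro nn_integral_cong)
    fix r :: real
    have "(\<integral>\<^sup>+x. f x * (?g r * ?I r x) \<partial>?M) = ?g r * (\<integral>\<^sup>+x. f x * ?I r x \<partial>?M)"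
      by (subst nn_integral_cmult[symmetric]) (simp_all add: mult_ac)
    also have "\<dots> = (ennreal (r * exp (- r\<^sup>2 / 2) * \<bar>r\<bar> ^ (L * DIM('a))) * indicator {0<..} r) * (\<integral>\<^sup>+x. f x * ?I 1 x \<partial>?M)"
    proof (cases "r > 0")
      case True
      then show ?thesis unfolding ball[OF True] by (simp add: ennreal_mult mult_ac)
    next
      case False
      \<comment> \<open>\<open>ennreal\<close> maps negative reals to 0, so radii up to 0 contribute
        nothing.\<close>
      then have "r * exp (- r\<^sup>2 / 2) \<le> 0" by (simp add: mult_nonpos_nonneg)
      then have "?g r = 0" by (rule ennreal_neg)
      then show ?thesis using False by simp
    qed
    finally show "(\<integral>\<^sup>+x. f x * (?g r * ?I r x) \<partial>?M) = \<dots>" .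
  qed
  also have "\<dots> = (\<integral>\<^sup>+r. ennreal (r * exp (- r\<^sup>2 / 2) * \<bar>r\<bar> ^ (L * DIM('a))) * indicator {0<..} r \<partial>lborel) * (\<integral>\<^sup>+x. f x * ?I 1 x \<partial>?M)"
    by (rule nn_integral_multc) measurable
  finally show ?thesis .
qed

text \<open>The certificate sees a row only through its direction, so one property covers Gaussian
  and spherical rows: the direction is distributed like that of a standard Gaussian vector.
  Multiplying by the mass avoids a division in \<open>ennreal\<close>.\<close>

definition gaussian_direction :: "nat \<Rightarrow> (nat \<Rightarrow> 'a::euclidean_space) measure \<Rightarrow> bool" where
  "gaussian_direction L R \<longleftrightarrow> prob_space R \<and> sets R = sets (PiM {..<L} (\<lambda>_. borel)) \<and>
    (\<forall>g\<in>borel_measurable (PiM {..<L} (\<lambda>_. borel)).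
      ennreal (gauss_mass TYPE('a) L) * (\<integral>\<^sup>+x. g (direction L x) \<partial>R) =
      (\<integral>\<^sup>+x. g (direction L x) * ennreal (gauss_weight L x) \<partial>lebesgue_vec L))"

lemma gaussian_direction_density:
  fixes R :: "(nat \<Rightarrow> 'a::euclidean_space) measure"
  assumes R: "R = density (lebesgue_vec L) (\<lambda>x. ennreal (gauss_weight L x / gauss_mass TYPE('a) L))"
  shows "gaussian_direction L R"
  unfolding gaussian_direction_def
proof (intro conjI ballI)
  let ?M = "lebesgue_vec L :: (nat \<Rightarrow> 'a) measure"
  let ?Z = "gauss_mass TYPE('a) L"
  show "sets R = sets (PiM {..<L} (\<lambda>_. borel))" by (simp add: R sets_lebesgue_vec)
  have int: "ennreal ?Z * (\<integral>\<^sup>+x. g x \<partial>R) = (\<integral>\<^sup>+x. g x * ennreal (gauss_weight L x) \<partial>?M)"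
    if [measurable]: "g \<in> borel_measurable ?M" for g
  proof -
    have "ennreal ?Z * (\<integral>\<^sup>+x. g x \<partial>R) = (\<integral>\<^sup>+x. ennreal ?Z * (ennreal (gauss_weight L x / ?Z) * g x) \<partial>?M)"
      unfolding R by (subst nn_integral_density) (simp_all add: nn_integral_cmult)
    also have "\<dots> = (\<integral>\<^sup>+x. g x * ennreal (gauss_weight L x) \<partial>?M)"
    proof (intro nn_integral_cong)
      fix x :: "nat \<Rightarrow> 'a"
      have "ennreal ?Z * ennreal (gauss_weight L x / ?Z) = ennreal (gauss_weight L x)"
        using gauss_mass_pos[where 'a='a, of L] by (subst ennreal_mult'[symmetric]) auto
      then show "ennreal ?Z * (ennreal (gauss_weight L x / ?Z) * g x) = g x * ennreal (gauss_weight L x)"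
        by (simp only: mult.assoc[symmetric]) (rule mult.commute)
    qed
    finally show ?thesis .
  qed
  show "prob_space R"
  proof
    have "ennreal ?Z * emeasure R (space R) = ennreal ?Z * 1"
      using int[of "\<lambda>_. 1"] by (simp add: nn_integral_gauss_weight)
    then show "emeasure R (space R) = 1"
      using gauss_mass_pos[where 'a='a, of L] by (subst (asm) ennreal_mult_cancel_left) auto
  qed
  fix g :: "(nat \<Rightarrow> 'a) \<Rightarrow> ennreal" assume [measurable]: "g \<in> borel_measurable (PiM {..<L} (\<lambda>_. borel))"
  show "ennreal ?Z * (\<integral>\<^sup>+x. g (direction L x) \<partial>R) = (\<integral>\<^sup>+x. g (direction L x) * ennreal (gauss_weight L x) \<partial>?M)"
    by (rule int) measurable
qed

text \<open>Layer-cake makes Gaussian and unit-ball integrals of direction functions proportional,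
  and the function 1 identifies the constant. The second normalisation is harmless because
  \<open>direction\<close> is idempotent.\<close>

lemma gaussian_direction_sphere_row:
  "gaussian_direction L (sphere_row L :: (nat \<Rightarrow> 'a::euclidean_space) measure)"
  unfolding gaussian_direction_def
proof (intro conjI ballI)
  let ?M = "lebesgue_vec L :: (nat \<Rightarrow> 'a) measure"
  let ?Z = "gauss_mass TYPE('a) L"
  let ?B = "{x \<in> space ?M. vnorm2 {..<L} x \<le> 1}"
  let ?C = "\<integral>\<^sup>+r. ennreal (r * exp (- r\<^sup>2 / 2) * \<bar>r\<bar> ^ (L * DIM('a))) * indicator {0<..} r \<partial>lborel"
  have B[measurable]: "?B \<in> sets ?M" by measurable
  have row: "sphere_row L = distr (uniform_measure ?M ?B) (PiM {..<L} (\<lambda>_. borel)) (direction L)"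
    unfolding sphere_row_def direction_def[abs_def] by simp
  have [measurable]: "direction L \<in> uniform_measure ?M ?B \<rightarrow>\<^sub>M PiM {..<L} (\<lambda>_. borel)"
    by (subst measurable_cong_sets[OF sets_uniform_measure refl]) measurable
  show "sets (sphere_row L :: (nat \<Rightarrow> 'a) measure) = sets (PiM {..<L} (\<lambda>_. borel))" by (simp add: row)
  have ind: "(\<integral>\<^sup>+x. f x * indicator {x. vnorm2 {..<L} x \<le> 1} x \<partial>?M) = (\<integral>\<^sup>+x. f x * indicator ?B x \<partial>?M)" for f
    by (intro nn_integral_cong) (simp add: indicator_def)
  have Z: "ennreal ?Z = ?C * emeasure ?M ?B"
    using nn_integral_homogeneous_gauss[of "\<lambda>_::nat \<Rightarrow> 'a. 1" L] unfolding ind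
    by (simp add: nn_integral_gauss_weight)
  \<comment> \<open>Positivity and finiteness of the Gaussian mass yield the same for the volume of
    the ball, without computing it.\<close>
  have "?C * emeasure ?M ?B \<noteq> 0" "?C * emeasure ?M ?B \<noteq> \<top>"
    unfolding Z[symmetric] using gauss_mass_pos[where 'a='a, of L] by (auto simp: ennreal_eq_0_iff dest: leD)
  then have B0: "emeasure ?M ?B \<noteq> 0" and Binf: "emeasure ?M ?B \<noteq> \<infinity>"
    by (auto simp: ennreal_mult_eq_top_iff)
  show "prob_space (sphere_row L :: (nat \<Rightarrow> 'a) measure)"
    unfolding row by (intro prob_space.prob_space_distr prob_space_uniform_measure B0 Binf) measurable
  fix g :: "(nat \<Rightarrow> 'a) \<Rightarrow> ennreal" assume [measurable]: "g \<in> borel_measurable (PiM {..<L} (\<lambda>_. borel))"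
  have "(\<integral>\<^sup>+x. g (direction L x) \<partial>sphere_row L) = (\<integral>\<^sup>+x. g (direction L x) * indicator ?B x \<partial>?M) / emeasure ?M ?B"
    unfolding row by (subst nn_integral_distr) (simp_all add: direction_direction nn_integral_uniform_measure)
  then have "ennreal ?Z * (\<integral>\<^sup>+x. g (direction L x) \<partial>sphere_row L) =
     ?C * (emeasure ?M ?B * ((\<integral>\<^sup>+x. g (direction L x) * indicator ?B x \<partial>?M) / emeasure ?M ?B))"
    unfolding Z by (simp add: mult.assoc)
  also have "emeasure ?M ?B * ((\<integral>\<^sup>+x. g (direction L x) * indicator ?B x \<partial>?M) / emeasure ?M ?B) = (\<integral>\<^sup>+x. g (direction L x) * indicator ?B x \<partial>?M)"
    using B0 Binf by (subst ennreal_times_divide, subst mult.commute, intro mult_divide_eq_ennreal) simp_all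
  also have "?C * \<dots> = (\<integral>\<^sup>+x. g (direction L x) * ennreal (gauss_weight L x) \<partial>?M)"
    by (subst nn_integral_homogeneous_gauss) (simp_all add: direction_vscale ind)
  finally show "ennreal ?Z * (\<integral>\<^sup>+x. g (direction L x) \<partial>sphere_row L) = (\<integral>\<^sup>+x. g (direction L x) * ennreal (gauss_weight L x) \<partial>?M)" .
qed

section \<open>Densities of the Gaussian rows\<close>

lemma PiM_gauss_density:
  "PiM {..<L} (\<lambda>_. density lborel (\<lambda>x::'a. ennreal (exp (- (norm x)\<^sup>2 / 2) / sqrt (2 * pi) ^ DIM('a)))) =
    density (lebesgue_vec L) (\<lambda>x. ennreal (gauss_weight L x / gauss_mass TYPE('a::euclidean_space) L))"
proof (rule sym)
  let ?M = "lebesgue_vec L :: (nat \<Rightarrow> 'a) measure"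
  let ?d = "\<lambda>x::'a. ennreal (exp (- (norm x)\<^sup>2 / 2) / sqrt (2 * pi) ^ DIM('a))"
  have "sigma_finite_measure (density lborel ?d)"
    by (rule sigma_finite_measure.sigma_finite_iff_density_finite'[OF sigma_finite_lborel, THEN iffD2]) auto
  then interpret D: product_sigma_finite "\<lambda>_::nat. density lborel ?d" by (rule product_sigma_finite.intro)
  show "density ?M (\<lambda>x. ennreal (gauss_weight L x / gauss_mass TYPE('a) L)) = PiM {..<L} (\<lambda>_. density lborel ?d)"
  proof (rule D.PiM_eqI)
    show "sets (density ?M (\<lambda>x. ennreal (gauss_weight L x / gauss_mass TYPE('a) L))) = sets (PiM {..<L} (\<lambda>_. density lborel ?d))"
      by (simp, intro sets_PiM_cong) auto
    fix A :: "nat \<Rightarrow> 'a set" assume A: "\<And>i. i \<in> {..<L} \<Longrightarrow> A i \<in> sets (density lborel ?d)"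
    then have A': "\<And>i. i \<in> {..<L} \<Longrightarrow> A i \<in> sets borel" by simp
    have PA: "Pi\<^sub>E {..<L} A \<in> sets ?M" using A by (intro sets_PiM_I_finite) auto
    have "emeasure (density ?M (\<lambda>x. ennreal (gauss_weight L x / gauss_mass TYPE('a) L))) (Pi\<^sub>E {..<L} A)
      = (\<integral>\<^sup>+x. ennreal (gauss_weight L x / gauss_mass TYPE('a) L) * indicator (Pi\<^sub>E {..<L} A) x \<partial>?M)"
      using PA by (intro emeasure_density) auto
    also have "\<dots> = (\<integral>\<^sup>+x. (\<Prod>t<L. ?d (x t) * indicator (A t) (x t)) \<partial>?M)"
    proof (intro nn_integral_cong)
      fix x :: "nat \<Rightarrow> 'a" assume "x \<in> space ?M"
      then have "indicator (Pi\<^sub>E {..<L} A) x = (\<Prod>t<L. indicator (A t) (x t) :: ennreal)"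
        by (auto simp: indicator_def space_PiM PiE_iff prod_zero_iff)
      moreover have "gauss_weight L x / gauss_mass TYPE('a) L = (\<Prod>t<L. exp (- (norm (x t))\<^sup>2 / 2) / sqrt (2 * pi) ^ DIM('a))"
        by (simp add: gauss_weight_prod gauss_mass_def prod_dividef power_mult[symmetric] mult.commute)
      ultimately show "ennreal (gauss_weight L x / gauss_mass TYPE('a) L) * indicator (Pi\<^sub>E {..<L} A) x
          = (\<Prod>t<L. ?d (x t) * indicator (A t) (x t))"
        by (simp add: prod.distrib prod_ennreal)
    qed
    also have "\<dots> = (\<Prod>t<L. \<integral>\<^sup>+x. ?d x * indicator (A t) x \<partial>lborel)"
      by (rule lborel_product.product_nn_integral_prod[where f = "\<lambda>t x. ?d x * indicator (A t) x"]) (use A' in auto)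
    also have "\<dots> = (\<Prod>t<L. emeasure (density lborel ?d) (A t))"
      using A' by (intro prod.cong refl emeasure_density[symmetric]) auto
    finally show "emeasure (density ?M (\<lambda>x. ennreal (gauss_weight L x / gauss_mass TYPE('a) L))) (Pi\<^sub>E {..<L} A)
      = (\<Prod>t<L. emeasure (density lborel ?d) (A t))" .
  qed simp
qed

lemma gaussian_direction_real_gauss_row: "gaussian_direction L (real_gauss_row L)"
proof (rule gaussian_direction_density)
  have "(\<lambda>x. ennreal (std_normal_density x)) = (\<lambda>x::real. ennreal (exp (- (norm x)\<^sup>2 / 2) / sqrt (2 * pi) ^ DIM(real)))"
    by (simp add: std_normal_density_def)
  then show "real_gauss_row L = density (lebesgue_vec L) (\<lambda>x. ennreal (gauss_weight L x / gauss_mass TYPE(real) L))"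
    unfolding real_gauss_row_def PiM_gauss_density[symmetric] by simp
qed

text \<open>Boxes determine Lebesgue measure, and a complex box is a product of two real intervals.
  This transports the joint density of real and imaginary part to \<open>complex\<close>.\<close>

lemma lborel_complex_eq: "lborel = distr (lborel \<Otimes>\<^sub>M lborel) borel (\<lambda>(a, b). Complex a b)"
proof (rule lborel_eqI)
  have [measurable]: "(\<lambda>(a, b). Complex a b) \<in> lborel \<Otimes>\<^sub>M lborel \<rightarrow>\<^sub>M borel"
    unfolding split_beta' Complex_eq by measurable
  fix l u :: complex assume le: "\<And>b. b \<in> Basis \<Longrightarrow> l \<bullet> b \<le> u \<bullet> b"
  have "Re l \<le> Re u" "Im l \<le> Im u" using le[of 1] le[of \<i>] by (auto simp: Basis_complex_def inner_complex_def)
  moreover have "(\<lambda>(a, b). Complex a b) -` box l u \<inter> space (lborel \<Otimes>\<^sub>M lborel) = {Re l<..<Re u} \<times> {Im l<..<Im u}"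
    by (auto simp: box_def Basis_complex_def inner_complex_def space_pair_measure)
  ultimately show "emeasure (distr (lborel \<Otimes>\<^sub>M lborel) borel (\<lambda>(a, b). Complex a b)) (box l u) = ennreal (\<Prod>b\<in>Basis. (u - l) \<bullet> b)"
    by (simp add: emeasure_distr lborel.emeasure_pair_measure_Times Basis_complex_def inner_complex_def ennreal_mult)
qed simp

lemma complex_std_normal_density:
  "complex_std_normal = density lborel (\<lambda>z::complex. ennreal (exp (- (norm z)\<^sup>2 / 2) / sqrt (2 * pi) ^ DIM(complex)))"
proof -
  let ?d = "\<lambda>x. ennreal (std_normal_density x)"
  have [measurable]: "(\<lambda>(a, b). Complex a b) \<in> lborel \<Otimes>\<^sub>M lborel \<rightarrow>\<^sub>M borel"
    unfolding split_beta' Complex_eq by measurable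
  interpret N: prob_space "density lborel ?d" by (rule prob_space_normal_density) simp
  have "density lborel ?d \<Otimes>\<^sub>M density lborel ?d = density (lborel \<Otimes>\<^sub>M lborel) (\<lambda>(a, b). ?d a * ?d b)"
    by (rule pair_measure_density) (auto intro: lborel.sigma_finite_measure_axioms N.sigma_finite_measure_axioms)
  also have "(\<lambda>(a, b). ?d a * ?d b) = (\<lambda>p. ennreal (exp (- (norm (case p of (a, b) \<Rightarrow> Complex a b))\<^sup>2 / 2) / sqrt (2 * pi) ^ DIM(complex)))"
    by (auto simp: fun_eq_iff std_normal_density_def ennreal_mult[symmetric] cmod_power2 exp_add[symmetric] add_divide_distrib)
  finally show ?thesis
    unfolding complex_std_normal_def by (subst lborel_complex_eq) (simp add: density_distr)
qed

lemma gaussian_direction_complex_gauss_row: "gaussian_direction L (complex_gauss_row L)"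
  by (rule gaussian_direction_density)
    (simp only: complex_gauss_row_def complex_std_normal_density PiM_gauss_density)

section \<open>Recovery\<close>

lemma measurable_row_direction:
  assumes R: "sets R = sets (PiM {..<L} (\<lambda>_. borel :: 'a::euclidean_space measure))" and "j \<in> S" "t < L"
  shows "(\<lambda>\<Phi>. direction L (\<Phi> j) t) \<in> borel_measurable (PiM S (\<lambda>_. R))"
proof -
  have "(\<lambda>\<Phi>. \<Phi> j) \<in> PiM S (\<lambda>_. R) \<rightarrow>\<^sub>M R"
    using \<open>j \<in> S\<close> by (intro measurable_component_singleton)
  also have "(PiM S (\<lambda>_. R) \<rightarrow>\<^sub>M R) = (PiM S (\<lambda>_. R) \<rightarrow>\<^sub>M PiM {..<L} (\<lambda>_. borel))"
    by (intro measurable_cong_sets refl R)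
  finally have "(\<lambda>\<Phi>. direction L (\<Phi> j)) \<in> PiM S (\<lambda>_. R) \<rightarrow>\<^sub>M PiM {..<L} (\<lambda>_. borel)"
    by (rule measurable_compose) (rule measurable_direction_borel)
  then show ?thesis
    by (rule measurable_compose) (use \<open>t < L\<close> in \<open>intro measurable_component_singleton, simp\<close>)
qed

lemma row_subgaussian:
  fixes R :: "(nat \<Rightarrow> 'a::euclidean_space) measure"
  assumes GD: "gaussian_direction L R" and L: "0 < L"
  shows "(\<integral>\<^sup>+x. ennreal (exp (vinner L (direction L x) h)) \<partial>R)
    \<le> ennreal (exp ((vnorm2 {..<L} h)\<^sup>2 / (2 * real (L * DIM('a)))))"
proof -
  let ?Z = "gauss_mass TYPE('a) L"
  let ?g = "\<lambda>x. ennreal (exp (vinner L x h))"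
  have "?g \<in> borel_measurable (PiM {..<L} (\<lambda>_. borel))" by measurable
  then have "ennreal ?Z * (\<integral>\<^sup>+x. ?g (direction L x) \<partial>R) =
      (\<integral>\<^sup>+x. ?g (direction L x) * ennreal (gauss_weight L x) \<partial>lebesgue_vec L)"
    using GD unfolding gaussian_direction_def by (elim conjE) (drule bspec, assumption, simp)
  also have "\<dots> \<le> ennreal ?Z * ennreal (exp ((vnorm2 {..<L} h)\<^sup>2 / (2 * real (L * DIM('a)))))"
    using direction_subgaussian[OF L, of h] by (simp add: ennreal_mult mult.commute)
  finally show ?thesis
    by (subst (asm) ennreal_mult_le_mult_iff) (auto simp: ennreal_eq_0_iff dest: leD)
qed

text \<open>A Gaussian vector \<open>h\<close> linearises the square, \<open>exp (\<theta> |y|\<^sup>2) = E exp (\<surd>(2\<theta>) \<langle>h, y\<rangle>)\<close>, after which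
  the independent rows factor.\<close>

lemma square_exp_moment_le:
  fixes R :: "(nat \<Rightarrow> 'a::euclidean_space) measure" and T T' :: "nat \<Rightarrow> 'a \<Rightarrow> 'a"
  assumes GD: "gaussian_direction L R" and L: "0 < L" and S: "finite S"
    and T: "\<And>j. T j \<in> borel \<rightarrow>\<^sub>M borel" and T': "\<And>j. T' j \<in> borel \<rightarrow>\<^sub>M borel"
    and adj: "\<And>j x y. y \<bullet> T j x = x \<bullet> T' j y"
    and bnd: "\<And>j y. norm (T' j y) \<le> b j * norm y"
    and b: "(\<Sum>j\<in>S. (b j)\<^sup>2) \<le> \<alpha>\<^sup>2" and \<alpha>: "0 < \<alpha>" "\<alpha> < 1"
  defines "\<theta> \<equiv> real (L * DIM('a)) * (1 / \<alpha>\<^sup>2 - 1) / 2"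
  shows "(\<integral>\<^sup>+\<Phi>. ennreal (exp (\<theta> * (vnorm2 {..<L} (\<lambda>t. \<Sum>j\<in>S. T j (direction L (\<Phi> j) t)))\<^sup>2)) \<partial>PiM S (\<lambda>_. R))
    \<le> ennreal (1 / \<alpha> ^ (L * DIM('a)))"
proof -
  let ?P = "PiM S (\<lambda>_. R)"
  let ?M = "lebesgue_vec L :: (nat \<Rightarrow> 'a) measure"
  let ?Z = "gauss_mass TYPE('a) L"
  define D where "D = real (L * DIM('a))"
  \<comment> \<open>Chosen so that the Gaussian moment generating function at \<open>s\<close> times
    \<open>y\<close> equals \<open>exp (\<theta> * |y|^2)\<close>.\<close>
  define s where "s = sqrt (2 * \<theta>)"
  have D: "D > 0" using L by (simp add: D_def)
  have a2: "\<alpha>\<^sup>2 < 1" using \<alpha> by (simp add: power_less_one_iff)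
  have \<theta>0: "\<theta> \<ge> 0" using D a2 \<alpha> unfolding \<theta>_def D_def by (intro divide_nonneg_pos mult_nonneg_nonneg) auto
  have s2: "s\<^sup>2 = 2 * \<theta>" using \<theta>0 by (simp add: s_def)
  interpret R: prob_space R using GD by (simp add: gaussian_direction_def)
  interpret PP: product_prob_space "\<lambda>_::nat. R" S by standard
  interpret P: prob_space ?P by (rule prob_space_PiM) (rule R.prob_space_axioms)
  interpret M: sigma_finite_measure ?M by (rule sigma_finite_lebesgue_vec)
  interpret PM: pair_sigma_finite ?P ?M by standard
  have sR: "sets R = sets (PiM {..<L} (\<lambda>_. borel))" using GD by (simp add: gaussian_direction_def)
  note [measurable] = T T' measurable_row_direction[OF sR]
  let ?Y = "\<lambda>\<Phi> t. \<Sum>j\<in>S. T j (direction L (\<Phi> j) t)"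
  let ?e = "\<lambda>\<Phi> h j. exp (vinner L (direction L (\<Phi> j)) (\<lambda>t. s *\<^sub>R T' j (h t)))"
  let ?F = "\<lambda>\<Phi> h. ennreal ((\<Prod>j\<in>S. ?e \<Phi> h j) * gauss_weight L h)"
  \<comment> \<open>Moving the adjoint \<open>T' j\<close> onto \<open>h\<close> splits the exponent
    into one term per row, hence the exponential into factors over independent rows.\<close>
  have lin: "ennreal (exp (\<theta> * (vnorm2 {..<L} (?Y \<Phi>))\<^sup>2)) * ennreal ?Z = (\<integral>\<^sup>+h. ?F \<Phi> h \<partial>?M)" for \<Phi>
  proof -
    have "vinner L h (\<lambda>t. s *\<^sub>R ?Y \<Phi> t) = (\<Sum>j\<in>S. vinner L (direction L (\<Phi> j)) (\<lambda>t. s *\<^sub>R T' j (h t)))" for h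
    proof -
      have "vinner L h (\<lambda>t. s *\<^sub>R ?Y \<Phi> t) = (\<Sum>t<L. \<Sum>j\<in>S. direction L (\<Phi> j) t \<bullet> (s *\<^sub>R T' j (h t)))"
        by (simp add: vinner_def inner_sum_right sum_distrib_left adj)
      also have "\<dots> = (\<Sum>j\<in>S. \<Sum>t<L. direction L (\<Phi> j) t \<bullet> (s *\<^sub>R T' j (h t)))" by (rule sum.swap)
      finally show ?thesis by (simp only: vinner_def)
    qed
    then have "(\<integral>\<^sup>+h. ?F \<Phi> h \<partial>?M) = (\<integral>\<^sup>+h. ennreal (exp (vinner L h (\<lambda>t. s *\<^sub>R ?Y \<Phi> t)) * gauss_weight L h) \<partial>?M)"
      using S by (simp add: exp_sum)
    also have "\<dots> = ennreal (exp ((vnorm2 {..<L} (\<lambda>t. s *\<^sub>R ?Y \<Phi> t))\<^sup>2 / 2) * ?Z)"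
      by (rule nn_integral_exp_vinner_gauss)
    also have "(vnorm2 {..<L} (\<lambda>t. s *\<^sub>R ?Y \<Phi> t))\<^sup>2 / 2 = \<theta> * (vnorm2 {..<L} (?Y \<Phi>))\<^sup>2"
      unfolding vnorm2_scale by (simp add: power_mult_distrib s2)
    finally show ?thesis by (simp add: ennreal_mult)
  qed
  have meas: "(\<lambda>(\<Phi>, h). ?F \<Phi> h) \<in> borel_measurable (?P \<Otimes>\<^sub>M ?M)"
  proof -
    have [measurable]: "(\<lambda>p. direction L (fst p j) t) \<in> borel_measurable (?P \<Otimes>\<^sub>M ?M)" if "j \<in> S" "t < L" for j t
      by (rule measurable_compose[OF measurable_fst]) (rule measurable_row_direction[OF sR that])
    have [measurable]: "(\<lambda>p. snd p t) \<in> borel_measurable (?P \<Otimes>\<^sub>M ?M)" if "t < L" for t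
      using that by (intro measurable_compose[OF measurable_snd]) simp
    have "(\<lambda>p. vinner L (direction L (fst p j)) (\<lambda>t. s *\<^sub>R T' j (snd p t))) \<in> borel_measurable (?P \<Otimes>\<^sub>M ?M)"
      if "j \<in> S" for j
      unfolding vinner_def using that by (intro borel_measurable_sum) measurable
    then have [measurable]: "(\<lambda>p. \<Prod>j\<in>S. ?e (fst p) (snd p) j) \<in> borel_measurable (?P \<Otimes>\<^sub>M ?M)"
      by (intro borel_measurable_prod measurable_compose[OF _ borel_measurable_exp])
    show ?thesis unfolding split_beta' by measurable
  qed
  have row: "(\<integral>\<^sup>+x. ennreal (exp (vinner L (direction L x) (\<lambda>t. s *\<^sub>R T' j (h t)))) \<partial>R)
      \<le> ennreal (exp ((1 / \<alpha>\<^sup>2 - 1) / 2 * (b j)\<^sup>2 * (vnorm2 {..<L} h)\<^sup>2))" for j h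
  proof -
    have "(vnorm2 {..<L} (\<lambda>t. T' j (h t)))\<^sup>2 \<le> (\<Sum>t<L. (b j * norm (h t))\<^sup>2)"
      unfolding vnorm2_square by (intro sum_mono power_mono bnd) simp
    also have "\<dots> = (b j)\<^sup>2 * (vnorm2 {..<L} h)\<^sup>2"
      by (simp add: vnorm2_square power_mult_distrib sum_distrib_left)
    finally have le: "(vnorm2 {..<L} (\<lambda>t. T' j (h t)))\<^sup>2 \<le> (b j)\<^sup>2 * (vnorm2 {..<L} h)\<^sup>2" .
    have "(vnorm2 {..<L} (\<lambda>t. s *\<^sub>R T' j (h t)))\<^sup>2 / (2 * D) = \<theta> / D * (vnorm2 {..<L} (\<lambda>t. T' j (h t)))\<^sup>2"
      unfolding vnorm2_scale by (simp add: power_mult_distrib s2)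
    also have "\<dots> \<le> \<theta> / D * ((b j)\<^sup>2 * (vnorm2 {..<L} h)\<^sup>2)"
      using \<theta>0 D le by (intro mult_left_mono) auto
    also have "\<theta> / D = (1 / \<alpha>\<^sup>2 - 1) / 2" using L unfolding \<theta>_def D_def by simp
    finally have "ennreal (exp ((vnorm2 {..<L} (\<lambda>t. s *\<^sub>R T' j (h t)))\<^sup>2 / (2 * D)))
      \<le> ennreal (exp ((1 / \<alpha>\<^sup>2 - 1) / 2 * (b j)\<^sup>2 * (vnorm2 {..<L} h)\<^sup>2))"
      by (intro ennreal_leI) (simp add: mult.assoc)
    then show ?thesis
      using row_subgaussian[OF GD L, of "\<lambda>t. s *\<^sub>R T' j (h t)"] unfolding D_def by (rule order_trans[rotated])
  qed
  have inner: "(\<integral>\<^sup>+\<Phi>. ?F \<Phi> h \<partial>?P) \<le> ennreal (1 * exp (- \<alpha>\<^sup>2 * (vnorm2 {..<L} h)\<^sup>2 / 2))" for h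
  proof -
    have vm: "(\<lambda>x. ennreal (exp (vinner L (direction L x) k))) \<in> borel_measurable R" for k :: "nat \<Rightarrow> 'a"
      by (subst measurable_cong_sets[OF sR refl]) measurable
    have vmP: "(\<lambda>\<Phi>. ennreal (?e \<Phi> h j)) \<in> borel_measurable ?P" if "j \<in> S" for j
      using measurable_component_singleton[OF that] by (rule measurable_compose) (rule vm)
    have "(\<integral>\<^sup>+\<Phi>. ?F \<Phi> h \<partial>?P) = (\<integral>\<^sup>+\<Phi>. ennreal (gauss_weight L h) * (\<Prod>j\<in>S. ennreal (?e \<Phi> h j)) \<partial>?P)"
      by (intro nn_integral_cong) (simp add: prod_ennreal ennreal_mult[symmetric] prod_nonneg mult.commute)
    also have "\<dots> = ennreal (gauss_weight L h) * (\<integral>\<^sup>+\<Phi>. (\<Prod>j\<in>S. ennreal (?e \<Phi> h j)) \<partial>?P)"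
      by (intro nn_integral_cmult borel_measurable_prod_ennreal vmP)
    also have "(\<integral>\<^sup>+\<Phi>. (\<Prod>j\<in>S. ennreal (?e \<Phi> h j)) \<partial>?P) =
        (\<Prod>j\<in>S. \<integral>\<^sup>+x. ennreal (exp (vinner L (direction L x) (\<lambda>t. s *\<^sub>R T' j (h t)))) \<partial>R)"
      by (rule PP.product_nn_integral_prod[OF S vm])
    also have "\<dots> \<le> (\<Prod>j\<in>S. ennreal (exp ((1 / \<alpha>\<^sup>2 - 1) / 2 * (b j)\<^sup>2 * (vnorm2 {..<L} h)\<^sup>2)))"
      by (intro prod_mono_ennreal row)
    also have "\<dots> = ennreal (exp (\<Sum>j\<in>S. (1 / \<alpha>\<^sup>2 - 1) / 2 * (b j)\<^sup>2 * (vnorm2 {..<L} h)\<^sup>2))"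
      using S by (simp add: exp_sum prod_ennreal)
    also have "(\<Sum>j\<in>S. (1 / \<alpha>\<^sup>2 - 1) / 2 * (b j)\<^sup>2 * (vnorm2 {..<L} h)\<^sup>2) =
        (1 / \<alpha>\<^sup>2 - 1) / 2 * (\<Sum>j\<in>S. (b j)\<^sup>2) * (vnorm2 {..<L} h)\<^sup>2"
      by (simp only: sum_distrib_left sum_distrib_right)
    also have "ennreal (gauss_weight L h) * ennreal (exp \<dots>) \<le>
        ennreal (gauss_weight L h) * ennreal (exp ((1 / \<alpha>\<^sup>2 - 1) / 2 * \<alpha>\<^sup>2 * (vnorm2 {..<L} h)\<^sup>2))"
      using b a2 \<alpha> by (intro mult_left_mono ennreal_leI) (auto intro!: mult_right_mono mult_left_mono)
    \<comment> \<open>Since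
      \<open>(1 / \<alpha>^2 - 1) / 2 * \<alpha>^2 = (1 - \<alpha>^2) / 2\<close>, the row bounds
      and the weight combine to a wider but still integrable Gaussian.\<close>
    also have "\<dots> = ennreal (1 * exp (- \<alpha>\<^sup>2 * (vnorm2 {..<L} h)\<^sup>2 / 2))"
      unfolding gauss_weight_def using \<alpha>
      by (subst ennreal_mult[symmetric]) (auto simp: exp_add[symmetric] field_simps)
    finally show ?thesis by (simp add: mult_left_mono)
  qed
  \<comment> \<open>Widening a Gaussian by \<open>1 / \<alpha>\<close> multiplies its mass by
    \<open>1 / \<alpha> ^ D\<close>, the origin of the moment bound. The factor 1 is the constant
    function in the scaling identity.\<close>
  have scaled: "ennreal (\<alpha> ^ (L * DIM('a))) * (\<integral>\<^sup>+h. ennreal (1 * exp (- \<alpha>\<^sup>2 * (vnorm2 {..<L} h)\<^sup>2 / 2)) \<partial>?M) = ennreal ?Z"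
    using nn_integral_gauss_scaled[OF \<alpha>(1), of "\<lambda>_::nat \<Rightarrow> 'a. 1" L] by (simp add: nn_integral_gauss_weight)
  let ?E = "\<integral>\<^sup>+\<Phi>. ennreal (exp (\<theta> * (vnorm2 {..<L} (?Y \<Phi>))\<^sup>2)) \<partial>?P"
  have Ym: "(\<lambda>\<Phi>. ennreal (exp (\<theta> * (vnorm2 {..<L} (?Y \<Phi>))\<^sup>2))) \<in> borel_measurable ?P"
    unfolding vnorm2_def by measurable
  have "?E * ennreal ?Z = (\<integral>\<^sup>+\<Phi>. ennreal (exp (\<theta> * (vnorm2 {..<L} (?Y \<Phi>))\<^sup>2)) * ennreal ?Z \<partial>?P)"
    by (rule nn_integral_multc[symmetric, OF Ym])
  also have "\<dots> = (\<integral>\<^sup>+\<Phi>. \<integral>\<^sup>+h. ?F \<Phi> h \<partial>?M \<partial>?P)" by (simp only: lin)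
  also have "\<dots> = (\<integral>\<^sup>+h. \<integral>\<^sup>+\<Phi>. ?F \<Phi> h \<partial>?P \<partial>?M)" by (rule PM.Fubini'[symmetric, OF meas])
  also have "\<dots> \<le> (\<integral>\<^sup>+h. ennreal (1 * exp (- \<alpha>\<^sup>2 * (vnorm2 {..<L} h)\<^sup>2 / 2)) \<partial>?M)"
    by (intro nn_integral_mono inner)
  finally have "ennreal (\<alpha> ^ (L * DIM('a))) * (?E * ennreal ?Z) \<le> ennreal ?Z"
    unfolding scaled[symmetric] by (rule mult_left_mono) simp
  then have "ennreal ?Z * (ennreal (\<alpha> ^ (L * DIM('a))) * ?E) \<le> ennreal ?Z * 1" by (simp only: mult_ac mult_1_left mult_1_right)
  then have "ennreal (\<alpha> ^ (L * DIM('a))) * ?E \<le> 1"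
    by (subst (asm) ennreal_mult_le_mult_iff) (auto simp: ennreal_eq_0_iff dest: leD)
  also have "1 = ennreal (\<alpha> ^ (L * DIM('a))) * ennreal (1 / \<alpha> ^ (L * DIM('a)))"
    using \<alpha> by (simp add: ennreal_mult[symmetric])
  finally show ?thesis
    using \<alpha> by (subst (asm) ennreal_mult_le_mult_iff) (auto simp: ennreal_eq_0_iff not_le)
qed


lemma exp_convex_combination_le:
  fixes u v k :: real
  assumes "0 \<le> k" "k \<le> 1"
  shows "exp (k * u + (1 - k) * v) \<le> k * exp u + (1 - k) * exp v"
  using convex_onD[OF exp_convex, of k v u] assms by (simp add: algebra_simps)

text \<open>For real rows the complex coefficients are split into real and imaginary parts, weighted by
  their shares \<open>k\<close> and \<open>1 - k\<close> of the squared norm; if a share is \<open>0\<close>, then so are the coefficients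
  and \<open>x / 0 = 0\<close> is the right value.\<close>

lemma square_exp_moment_le_real:
  fixes R :: "(nat \<Rightarrow> real) measure" and c :: "nat \<Rightarrow> complex"
  assumes GD: "gaussian_direction L R" and L: "0 < L" and S: "finite S"
    and c: "vnorm2 S c \<le> \<alpha>" and \<alpha>: "0 < \<alpha>" "\<alpha> < 1"
  shows "(\<integral>\<^sup>+\<Phi>. ennreal (exp (real (L * DIM(real)) * (1 / \<alpha>\<^sup>2 - 1) / 2 *
      (vnorm2 {..<L} (\<lambda>t. \<Sum>j\<in>S. cnj (c j) * complex_of_real (direction L (\<Phi> j) t)))\<^sup>2)) \<partial>PiM S (\<lambda>_. R))
    \<le> ennreal (1 / \<alpha> ^ (L * DIM(real)))"
proof -
  let ?P = "PiM S (\<lambda>_. R)"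
  define \<theta> where "\<theta> = real (L * DIM(real)) * (1 / \<alpha>\<^sup>2 - 1) / 2"
  define A2 where "A2 = (\<Sum>j\<in>S. (norm (c j))\<^sup>2)"
  define k where "k = (\<Sum>j\<in>S. (Re (c j))\<^sup>2) / A2"
  let ?p = "\<lambda>j. Re (c j) / sqrt k"
  let ?q = "\<lambda>j. Im (c j) / sqrt (1 - k)"
  let ?Q = "\<lambda>r \<Phi>. (vnorm2 {..<L} (\<lambda>t. \<Sum>j\<in>S. r j * direction L (\<Phi> j) t))\<^sup>2"
  let ?X = "\<lambda>\<Phi>. (vnorm2 {..<L} (\<lambda>t. \<Sum>j\<in>S. cnj (c j) * complex_of_real (direction L (\<Phi> j) t)))\<^sup>2"
  have A2: "A2 = (\<Sum>j\<in>S. (Re (c j))\<^sup>2) + (\<Sum>j\<in>S. (Im (c j))\<^sup>2)"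
    by (simp add: A2_def cmod_power2 sum.distrib)
  have A2\<alpha>: "A2 \<le> \<alpha>\<^sup>2" unfolding A2_def vnorm2_square[symmetric] using c by (intro power_mono) auto
  have re0: "0 \<le> (\<Sum>j\<in>S. (Re (c j))\<^sup>2)" and im0: "0 \<le> (\<Sum>j\<in>S. (Im (c j))\<^sup>2)" by (auto intro: sum_nonneg)
  have A20: "0 \<le> A2" using re0 im0 A2 by linarith
  have k: "0 \<le> k" "k \<le> 1" unfolding k_def using re0 im0 A2 A20 by (auto intro!: divide_le_eq_1_pos[THEN iffD2] simp: divide_le_eq)
  have sum_re: "(\<Sum>j\<in>S. (Re (c j))\<^sup>2) = k * A2"
    using A2 re0 im0 by (cases "A2 = 0") (auto simp: k_def)
  have sum_im: "(\<Sum>j\<in>S. (Im (c j))\<^sup>2) = (1 - k) * A2"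
    using sum_re A2 by (simp add: algebra_simps)
  have re: "Re (c j) = sqrt k * ?p j" if "j \<in> S" for j
  proof (cases "k = 0")
    case True
    then have "(\<Sum>j\<in>S. (Re (c j))\<^sup>2) = 0" using sum_re by simp
    then show ?thesis using S that True by (simp add: sum_nonneg_eq_0_iff)
  qed (use k in simp)
  have im: "Im (c j) = sqrt (1 - k) * ?q j" if "j \<in> S" for j
  proof (cases "k = 1")
    case True
    then have "(\<Sum>j\<in>S. (Im (c j))\<^sup>2) = 0" using sum_im by simp
    then show ?thesis using S that True by (simp add: sum_nonneg_eq_0_iff)
  qed (use k in simp)
  \<comment> \<open>After division by its share each family has total weight \<open>A2\<close>, or 0
    if the share is 0.\<close>
  have p: "(\<Sum>j\<in>S. (\<bar>?p j\<bar>)\<^sup>2) \<le> \<alpha>\<^sup>2"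
    using sum_re A20 A2\<alpha> k by (cases "k = 0") (auto simp: power_divide sum_divide_distrib[symmetric])
  have q: "(\<Sum>j\<in>S. (\<bar>?q j\<bar>)\<^sup>2) \<le> \<alpha>\<^sup>2"
    using sum_im A20 A2\<alpha> k by (cases "k = 1") (auto simp: power_divide sum_divide_distrib[symmetric])
  have mom: "(\<integral>\<^sup>+\<Phi>. ennreal (exp (\<theta> * ?Q r \<Phi>)) \<partial>?P) \<le> ennreal (1 / \<alpha> ^ (L * DIM(real)))"
    if "(\<Sum>j\<in>S. (\<bar>r j\<bar>)\<^sup>2) \<le> \<alpha>\<^sup>2" for r :: "nat \<Rightarrow> real"
    unfolding \<theta>_def
    by (rule square_exp_moment_le[OF GD L S, where T = "\<lambda>j x. r j * x" and T' = "\<lambda>j x. r j * x" and b = "\<lambda>j. \<bar>r j\<bar>"])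
      (use that \<alpha> in \<open>auto simp: abs_mult\<close>)
  \<comment> \<open>Both sums involve the same rows and are dependent. Writing the square as a
    convex combination lets convexity of \<open>exp\<close> replace any joint law.\<close>
  have split: "?X \<Phi> = k * ?Q ?p \<Phi> + (1 - k) * ?Q ?q \<Phi>" for \<Phi>
  proof -
    let ?d = "\<lambda>j t. direction L (\<Phi> j) t"
    have lin: "(\<Sum>t<L. (sqrt k * u t)\<^sup>2 + (sqrt (1 - k) * v t)\<^sup>2) =
        k * (\<Sum>t<L. (norm (u t))\<^sup>2) + (1 - k) * (\<Sum>t<L. (norm (v t))\<^sup>2)" for u v :: "nat \<Rightarrow> real"
      using k by (simp add: power_mult_distrib sum.distrib sum_distrib_left)
    have "?X \<Phi> = (\<Sum>t<L. (\<Sum>j\<in>S. Re (c j) * ?d j t)\<^sup>2 + (\<Sum>j\<in>S. Im (c j) * ?d j t)\<^sup>2)"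
      unfolding vnorm2_square by (intro sum.cong refl) (simp add: cmod_power2 sum_negf)
    also have "\<dots> = (\<Sum>t<L. (sqrt k * (\<Sum>j\<in>S. ?p j * ?d j t))\<^sup>2 + (sqrt (1 - k) * (\<Sum>j\<in>S. ?q j * ?d j t))\<^sup>2)"
      unfolding sum_distrib_left mult.assoc[symmetric] using re im
      by (intro sum.cong refl arg_cong2[where f = "(+)"] arg_cong[where f = "\<lambda>x. x\<^sup>2"]) auto
    also have "\<dots> = k * ?Q ?p \<Phi> + (1 - k) * ?Q ?q \<Phi>"
      unfolding vnorm2_square by (rule lin)
    finally show ?thesis .
  qed
  have sR: "sets R = sets (PiM {..<L} (\<lambda>_. borel))" using GD by (simp add: gaussian_direction_def)
  note [measurable] = measurable_row_direction[OF sR]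
  have Qm[measurable]: "?Q r \<in> borel_measurable ?P" for r
    unfolding vnorm2_def by measurable
  have Em[measurable]: "(\<lambda>\<Phi>. ennreal (exp (\<theta> * ?Q r \<Phi>))) \<in> borel_measurable ?P" for r by measurable
  have "(\<integral>\<^sup>+\<Phi>. ennreal (exp (\<theta> * ?X \<Phi>)) \<partial>?P)
      \<le> (\<integral>\<^sup>+\<Phi>. ennreal k * ennreal (exp (\<theta> * ?Q ?p \<Phi>)) + ennreal (1 - k) * ennreal (exp (\<theta> * ?Q ?q \<Phi>)) \<partial>?P)"
  proof (rule nn_integral_mono)
    fix \<Phi>
    have "\<theta> * ?X \<Phi> = k * (\<theta> * ?Q ?p \<Phi>) + (1 - k) * (\<theta> * ?Q ?q \<Phi>)"
      unfolding split by (simp only: distrib_left mult.left_commute)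
    then have "exp (\<theta> * ?X \<Phi>) \<le> k * exp (\<theta> * ?Q ?p \<Phi>) + (1 - k) * exp (\<theta> * ?Q ?q \<Phi>)"
      using exp_convex_combination_le[OF k] by simp
    then have "ennreal (exp (\<theta> * ?X \<Phi>)) \<le> ennreal (k * exp (\<theta> * ?Q ?p \<Phi>) + (1 - k) * exp (\<theta> * ?Q ?q \<Phi>))"
      by (rule ennreal_leI)
    then show "ennreal (exp (\<theta> * ?X \<Phi>)) \<le> ennreal k * ennreal (exp (\<theta> * ?Q ?p \<Phi>)) + ennreal (1 - k) * ennreal (exp (\<theta> * ?Q ?q \<Phi>))"
      using k by (simp add: ennreal_mult)
  qed
  also have "\<dots> = ennreal k * (\<integral>\<^sup>+\<Phi>. ennreal (exp (\<theta> * ?Q ?p \<Phi>)) \<partial>?P) + ennreal (1 - k) * (\<integral>\<^sup>+\<Phi>. ennreal (exp (\<theta> * ?Q ?q \<Phi>)) \<partial>?P)"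
    unfolding nn_integral_cmult[OF Em, symmetric] by (rule nn_integral_add) measurable
  also have "\<dots> \<le> ennreal k * ennreal (1 / \<alpha> ^ (L * DIM(real))) + ennreal (1 - k) * ennreal (1 / \<alpha> ^ (L * DIM(real)))"
    by (intro add_mono mult_left_mono mom p q) auto
  also have "\<dots> = ennreal (k + (1 - k)) * ennreal (1 / \<alpha> ^ (L * DIM(real)))"
    using k by (subst ennreal_plus) (simp_all only: distrib_right)
  finally show ?thesis by (simp add: \<theta>_def)
qed

text \<open>For the real inner product on \<open>complex\<close>, multiplication by
  \<open>cnj (c j)\<close> has multiplication by \<open>c j\<close> as its adjoint, and both have
  operator norm \<open>norm (c j)\<close>.\<close>

lemma square_exp_moment_le_complex:
  fixes R :: "(nat \<Rightarrow> complex) measure" and c :: "nat \<Rightarrow> complex"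
  assumes GD: "gaussian_direction L R" and L: "0 < L" and S: "finite S"
    and c: "vnorm2 S c \<le> \<alpha>" and \<alpha>: "0 < \<alpha>" "\<alpha> < 1"
  shows "(\<integral>\<^sup>+\<Phi>. ennreal (exp (real (L * DIM(complex)) * (1 / \<alpha>\<^sup>2 - 1) / 2 *
      (vnorm2 {..<L} (\<lambda>t. \<Sum>j\<in>S. cnj (c j) * id (direction L (\<Phi> j) t)))\<^sup>2)) \<partial>PiM S (\<lambda>_. R))
    \<le> ennreal (1 / \<alpha> ^ (L * DIM(complex)))"
  unfolding id_apply
proof (rule square_exp_moment_le[OF GD L S, where T = "\<lambda>j x. cnj (c j) * x" and T' = "\<lambda>j x. c j * x" and b = "\<lambda>j. norm (c j)"])
  show "(\<Sum>j\<in>S. (norm (c j))\<^sup>2) \<le> \<alpha>\<^sup>2"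
    unfolding vnorm2_square[symmetric] using c by (intro power_mono) auto
qed (use \<alpha> in \<open>auto simp: norm_mult inner_complex_def algebra_simps\<close>)

text \<open>The argument common to all four models, which differ in \<open>emb\<close>, in the real
  dimension and in how \<open>moment\<close> is obtained.\<close>

lemma recovery_prob_ge:
  fixes R :: "(nat \<Rightarrow> 'a::euclidean_space) measure"
  assumes S_sub: "S \<subseteq> {..<N}" and rank: "full_col_rank n A S"
    and \<alpha>: "0 < \<alpha>" "\<alpha> < 1"
    and coh: "\<forall>l<N. l \<notin> S \<longrightarrow> vnorm2 S (pinv_apply n A S (\<lambda>i. A i l)) \<le> \<alpha>"
    and sigma_pos: "\<forall>j\<in>S. 0 < \<sigma> j" and L: "0 < L"
    and GD: "gaussian_direction L R"
    and emb[measurable]: "emb \<in> borel \<rightarrow>\<^sub>M borel"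
    and emb_norm: "\<And>x. norm (emb x) = norm x"
    and emb_scale: "\<And>r x. emb (r *\<^sub>R x) = complex_of_real r * emb x"
    and moment: "\<And>c. vnorm2 S c \<le> \<alpha> \<Longrightarrow>
      (\<integral>\<^sup>+\<Phi>. ennreal (exp (real (L * DIM('a)) * (1 / \<alpha>\<^sup>2 - 1) / 2 *
        (vnorm2 {..<L} (\<lambda>t. \<Sum>j\<in>S. cnj (c j) * emb (direction L (\<Phi> j) t)))\<^sup>2)) \<partial>PiM S (\<lambda>_. R))
      \<le> ennreal (1 / \<alpha> ^ (L * DIM('a)))"
  shows "recovery_prob n N L A S \<sigma> emb R
    \<ge> 1 - real N * exp (- (real (L * DIM('a)) / 2) * (\<alpha> powr (-2) - ln (\<alpha> powr (-2)) - 1))"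
proof -
  let ?P = "PiM S (\<lambda>_. R)"
  define D where "D = L * DIM('a)"
  define \<theta> where "\<theta> = real D * (1 / \<alpha>\<^sup>2 - 1) / 2"
  define \<beta> where "\<beta> = exp (- (real D / 2) * (\<alpha> powr (-2) - ln (\<alpha> powr (-2)) - 1))"
  interpret R: prob_space R using GD by (simp add: gaussian_direction_def)
  interpret P: prob_space ?P by (rule prob_space_PiM) (rule R.prob_space_axioms)
  have sR: "sets R = sets (PiM {..<L} (\<lambda>_. borel))" using GD by (simp add: gaussian_direction_def)
  have \<theta>0: "0 \<le> \<theta>"
    unfolding \<theta>_def using \<alpha> by (intro divide_nonneg_pos mult_nonneg_nonneg) (auto simp: power_le_one)
  \<comment> \<open>At this \<theta> the Markov bound equals the claimed failure probability per
    column; nothing is lost here.\<close>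
  have \<beta>: "exp (- \<theta>) * (1 / \<alpha> ^ D) = \<beta>"
  proof -
    have "\<alpha> powr (-2) = 1 / \<alpha>\<^sup>2" using \<alpha> by (simp add: powr_minus_divide powr_numeral)
    moreover have "1 / \<alpha> ^ D = exp (- real D * ln \<alpha>)"
      using \<alpha> by (simp add: exp_minus exp_of_nat_mult divide_inverse)
    moreover have "ln (\<alpha> powr (-2)) = -2 * ln \<alpha>" using \<alpha> by (simp add: ln_powr)
    ultimately show ?thesis
      unfolding \<beta>_def \<theta>_def by (simp add: exp_add[symmetric] algebra_simps diff_divide_distrib add_divide_distrib)
  qed
  let ?c = "\<lambda>l. pinv_apply n A S (\<lambda>i. A i l)"
  let ?W = "\<lambda>l \<Phi>. vnorm2 {..<L} (\<lambda>t. \<Sum>j\<in>S. cnj (?c l j) * emb (direction L (\<Phi> j) t))"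
  let ?bad = "\<lambda>l. {\<Phi> \<in> space ?P. 1 \<le> ?W l \<Phi>}"
  let ?good = "{\<Phi> \<in> space ?P. unique_l21_solution n N L A (signal_mat S L \<sigma> emb \<Phi>)}"
  note [measurable] = measurable_row_direction[OF sR]
  have [measurable]: "?W l \<in> borel_measurable ?P" for l
    unfolding vnorm2_def by measurable
  have bad[measurable]: "?bad l \<in> sets ?P" for l by measurable
  have good: "?good \<in> sets ?P"
    using sets_unique_l21_solution[OF sR S_sub emb] unfolding rows_model_def .
  have tail: "measure ?P (?bad l) \<le> \<beta>" if "l < N" "l \<notin> S" for l
  proof -
    have "emeasure ?P (?bad l) = (\<integral>\<^sup>+\<Phi>. indicator (?bad l) \<Phi> \<partial>?P)" by simp
    also have "\<dots> \<le> (\<integral>\<^sup>+\<Phi>. ennreal (exp (- \<theta>)) * ennreal (exp (\<theta> * (?W l \<Phi>)\<^sup>2)) \<partial>?P)"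
    proof (rule nn_integral_mono)
      fix \<Phi>
      show "indicator (?bad l) \<Phi> \<le> ennreal (exp (- \<theta>)) * ennreal (exp (\<theta> * (?W l \<Phi>)\<^sup>2))"
      proof (cases "\<Phi> \<in> ?bad l")
        case True
        then have "1 \<le> (?W l \<Phi>)\<^sup>2" by simp
        then have "0 \<le> - \<theta> + \<theta> * (?W l \<Phi>)\<^sup>2"
          using mult_left_mono[OF _ \<theta>0, of 1 "(?W l \<Phi>)\<^sup>2"] by simp
        then have "1 \<le> exp (- \<theta>) * exp (\<theta> * (?W l \<Phi>)\<^sup>2)" by (simp add: exp_add[symmetric])
        then have "ennreal 1 \<le> ennreal (exp (- \<theta>) * exp (\<theta> * (?W l \<Phi>)\<^sup>2))" by (rule ennreal_leI)
        then show ?thesis using True by (simp add: ennreal_mult)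
      qed simp
    qed
    also have "\<dots> = ennreal (exp (- \<theta>)) * (\<integral>\<^sup>+\<Phi>. ennreal (exp (\<theta> * (?W l \<Phi>)\<^sup>2)) \<partial>?P)"
      by (rule nn_integral_cmult) measurable
    also have "\<dots> \<le> ennreal (exp (- \<theta>)) * ennreal (1 / \<alpha> ^ D)"
      unfolding \<theta>_def D_def using coh that by (intro mult_left_mono moment) auto
    also have "\<dots> = ennreal \<beta>"
      unfolding \<beta>[symmetric] using \<alpha> by (intro ennreal_mult[symmetric]) auto
    finally show ?thesis unfolding P.emeasure_eq_measure by (simp add: \<beta>_def)
  qed
  have sub: "space ?P - ?good \<subseteq> (\<Union>l\<in>{..<N} - S. ?bad l)"
  proof
    fix \<Phi> assume \<Phi>: "\<Phi> \<in> space ?P - ?good"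
    show "\<Phi> \<in> (\<Union>l\<in>{..<N} - S. ?bad l)"
    proof (rule ccontr)
      assume "\<not> ?thesis"
      then have dual: "?W l \<Phi> < 1" if "l < N" "l \<notin> S" for l using that \<Phi> by force
      let ?X = "signal_mat S L \<sigma> emb \<Phi>"
      let ?sg = "\<lambda>j t. emb (direction L (\<Phi> j) t)"
      have sgn: "vnorm2 {..<L} (?sg j) = vnorm2 {..<L} (direction L (\<Phi> j))" for j
        by (rule vnorm2_cong) (rule emb_norm)
      have X: "?X j t = complex_of_real (\<sigma> j * vnorm2 {..<L} (\<Phi> j)) * ?sg j t" if "j \<in> S" "t < L" for j t
      proof -
        have "\<Phi> j t = vnorm2 {..<L} (\<Phi> j) *\<^sub>R direction L (\<Phi> j) t"
          using that vnorm2_eq_0[of "{..<L}" "\<Phi> j"] by (cases "vnorm2 {..<L} (\<Phi> j) = 0") (auto simp: direction_def)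
        then have "emb (\<Phi> j t) = complex_of_real (vnorm2 {..<L} (\<Phi> j)) * ?sg j t" using emb_scale by metis
        then show ?thesis using that by (simp add: signal_mat_def)
      qed
      have "unique_l21_solution n N L A ?X"
      proof (rule unique_l21_solutionI[OF S_sub rank, where sg = ?sg])
        show "?X \<in> cmats N L" using S_sub by (auto simp: cmats_def signal_mat_def)
        show "?X j t = 0" if "j \<notin> S" for j t using that by (simp add: signal_mat_def)
        show "vnorm2 {..<L} (?sg j) \<le> 1" for j unfolding sgn by (rule vnorm2_direction_le)
        show "?W l \<Phi> < 1" if "l < N" "l \<notin> S" for l by (rule dual[OF that])
        fix j assume j: "j \<in> S"
        let ?k = "\<sigma> j * vnorm2 {..<L} (\<Phi> j)"
        have k: "0 \<le> ?k" using sigma_pos j by (simp add: less_imp_le)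
        have "cdot L (?sg j) (?X j) = cdot L (?sg j) (\<lambda>t. complex_of_real ?k * ?sg j t)"
          unfolding cdot_def using X[OF j] by (intro sum.cong) auto
        then have "Re (cdot L (?sg j) (?X j)) = ?k * (vnorm2 {..<L} (?sg j))\<^sup>2"
          unfolding cdot_scale cdot_self vnorm2_square by simp
        moreover have "vnorm2 {..<L} (?X j) = ?k * vnorm2 {..<L} (?sg j)"
        proof -
          have "vnorm2 {..<L} (?X j) = vnorm2 {..<L} (\<lambda>t. ?k *\<^sub>R ?sg j t)"
            using X[OF j] by (intro vnorm2_cong) (simp add: scaleR_conv_of_real)
          then show ?thesis using k by (simp only: vnorm2_scale abs_of_nonneg)
        qed
        \<comment> \<open>A direction has length 0 or 1, both fixed by squaring; zero rows thus need
          no null-set argument.\<close>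
        moreover have "(vnorm2 {..<L} (?sg j))\<^sup>2 = vnorm2 {..<L} (?sg j)"
          unfolding sgn by (simp add: direction_def vnorm2_vscale)
        ultimately show "Re (cdot L (?sg j) (?X j)) = vnorm2 {..<L} (?X j)" by simp
      qed
      then show False using \<Phi> by simp
    qed
  qed
  have "measure ?P (space ?P - ?good) \<le> measure ?P (\<Union>l\<in>{..<N} - S. ?bad l)"
    by (rule P.finite_measure_mono[OF sub]) (intro sets.finite_UN bad, simp)
  also have "\<dots> \<le> (\<Sum>l\<in>{..<N} - S. measure ?P (?bad l))"
    by (rule P.finite_measure_subadditive_finite) auto
  also have "\<dots> \<le> (\<Sum>l\<in>{..<N} - S. \<beta>)" by (rule sum_mono) (use tail in auto)
  also have "\<dots> \<le> real N * \<beta>"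
    using card_mono[of "{..<N}" "{..<N} - S"] by (simp add: \<beta>_def)
  finally have "1 - real N * \<beta> \<le> measure ?P ?good"
    using P.prob_compl[OF good] by linarith
  then show ?thesis unfolding recovery_prob_def rows_model_def \<beta>_def D_def .
qed

theorem theorem3:
  fixes n N L :: nat
    and A :: "nat \<Rightarrow> nat \<Rightarrow> complex"
    and S :: "nat set"
    and \<alpha> :: real
    and \<sigma> :: "nat \<Rightarrow> real"
  assumes S_sub: "S \<subseteq> {..<N}"
    and rank: "full_col_rank n A S"
    and alpha_pos: "0 < \<alpha>"
    and alpha_lt: "\<alpha> < 1"
    and coh: "\<forall>l<N. l \<notin> S \<longrightarrow> vnorm2 S (pinv_apply n A S (\<lambda>i. A i l)) \<le> \<alpha>"
    and sigma_pos: "\<forall>j\<in>S. 0 < \<sigma> j"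
    and L_pos: "0 < L"
  shows "recovery_prob n N L A S \<sigma> complex_of_real (real_gauss_row L)
           \<ge> 1 - real N * exp (- (real L / 2) * (\<alpha> powr (-2) - ln (\<alpha> powr (-2)) - 1))
       \<and> recovery_prob n N L A S \<sigma> complex_of_real (sphere_row L)
           \<ge> 1 - real N * exp (- (real L / 2) * (\<alpha> powr (-2) - ln (\<alpha> powr (-2)) - 1))
       \<and> recovery_prob n N L A S \<sigma> id (complex_gauss_row L)
           \<ge> 1 - real N * exp (- real L * (\<alpha> powr (-2) - ln (\<alpha> powr (-2)) - 1))
       \<and> recovery_prob n N L A S \<sigma> id (sphere_row L)
           \<ge> 1 - real N * exp (- real L * (\<alpha> powr (-2) - ln (\<alpha> powr (-2)) - 1))"
proof -
  have fin: "finite S" using S_sub finite_subset by blast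
  note ge = recovery_prob_ge[OF S_sub rank alpha_pos alpha_lt coh sigma_pos L_pos]
  \<comment> \<open>\<open>DIM(real) = 1\<close> produces the factor \<open>L / 2\<close>, and
    \<open>DIM(complex) = 2\<close> below produces \<open>L\<close>.\<close>
  have real: "recovery_prob n N L A S \<sigma> complex_of_real R
      \<ge> 1 - real N * exp (- (real (L * DIM(real)) / 2) * (\<alpha> powr (-2) - ln (\<alpha> powr (-2)) - 1))"
    if "gaussian_direction L R" for R
    by (rule ge[OF that _ _ _ square_exp_moment_le_real[OF that L_pos fin _ alpha_pos alpha_lt]]) simp_all
  have complex: "recovery_prob n N L A S \<sigma> id R
      \<ge> 1 - real N * exp (- (real (L * DIM(complex)) / 2) * (\<alpha> powr (-2) - ln (\<alpha> powr (-2)) - 1))"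
    if "gaussian_direction L R" for R
    by (rule ge[OF that _ _ _ square_exp_moment_le_complex[OF that L_pos fin _ alpha_pos alpha_lt]])
      (simp_all add: scaleR_conv_of_real)
  show ?thesis
    using real[OF gaussian_direction_real_gauss_row] real[OF gaussian_direction_sphere_row]
      complex[OF gaussian_direction_complex_gauss_row] complex[OF gaussian_direction_sphere_row]
    by simp
qed

end
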